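(* Let $N\ge2$, let $X_1,\dots,X_N$ be Polish spaces, $\rho_i\in\mathcal P(X_i)$ Borel probability measures, and $c:X_1\times\cdots\times X_N\to[0,+\infty]$ lower semicontinuous such that, for some $\mathcal K<+\infty$ and every $i=1,\dots,N$, $\sup_{x_i\in X_i}\int_{\prod_{j\ne i}X_j}c(x_1,\dots,x_N)\,d\bigotimes_{j\neq i}\rho_j\le\mathcal K$. Let $\varepsilon>0$ and let $(u_1^0,\dots,u_N^0)$ satisfy $\mathcal D^N_\varepsilon(u_1^0,\dots,u_N^0)\ge0$, $\int u_i^0\,d\rho_i\ge0$ and $-(N-1)\mathcal K\le u_i^0\le\mathcal K$ for every $i$. For $n\ge0$ define successively, for $i=1,\dots,N$, $$u_i^{n+1}:=(u_1^{n+1},\dots,u_{i-1}^{n+1},u_{i+1}^n,\dots,u_N^n)^{c,\varepsilon}.$$ Then the sequence $(u_1^n,\dots,u_N^n)_n$ converges, uniformly on compact sets, to a maximizer $(\bar u_1,\dots,\bar u_N)$ of $\mathcal D^N_\varepsilon$ over $L^1_{\rho_1}\times\cdots\times L^1_{\rho_N}$ (the maximizer being unique up to adding constants $a_1,\dots,a_N$ with $\sum_i a_i=0$).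
   Context: With $\rho^N=\rho_1\otimes\cdots\otimes\rho_N$ and $e^{-\infty}=0$, for $u_i\in L^1_{\rho_i}$, $$\mathcal D^N_\varepsilon(u_1,\dots,u_N)=\sum_{i=1}^N\int_{X_i}u_i\,d\rho_i-\varepsilon\int e^{\frac{\sum_{i=1}^N u_i(x_i)-c(x_1,\dots,x_N)}{\varepsilon}}\,d\rho^N+\varepsilon\in[-\infty,+\infty).$$ The $(c,\varepsilon)$-transform of functions $(u_j)_{j\ne i}$ on $X_j$, $j\neq i$, is the function on $X_i$ given pointwise by $$(u_1,\dots,u_{i-1},u_{i+1},\dots,u_N)^{c,\varepsilon}(x_i)=-\varepsilon\log\int_{\prod_{j\ne i}X_j}e^{\frac{\sum_{j\ne i}u_j(x_j)-c(x_1,\dots,x_N)}{\varepsilon}}\,d\bigotimes_{j\ne i}\rho_j.$$ An initial tuple with the stated properties always exists. *)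

theory Defs
  imports "HOL-Probability.Probability"
begin

text \<open>
  The spaces \<open>X 1, \<dots>, X N\<close> are topologies on one carrier type, so they may have
  different underlying sets. A tuple of points is an element of the extensional product
  over \<open>{1..N}\<close>, and a tuple of functions is an indexed family \<open>u :: nat \<Rightarrow> 'a \<Rightarrow> real\<close> of which
  only the members with index in \<open>{1..N}\<close> matter.
\<close>

definition polish_topology :: "'a topology \<Rightarrow> bool" where
  "polish_topology X \<longleftrightarrow> completely_metrizable_space X \<and> separable_space X"

definition borel_of :: "'a topology \<Rightarrow> 'a measure" where
  "borel_of X = sigma (topspace X) {U. openin X U}"

definition lsc_map :: "'a topology \<Rightarrow> ('a \<Rightarrow> 'b::linorder) \<Rightarrow> bool" where
  "lsc_map X f \<longleftrightarrow> (\<forall>a. openin X {x \<in> topspace X. a < f x})"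

text \<open>\<open>gibbs \<epsilon> t k\<close> is \<open>exp ((t - k) / \<epsilon>)\<close>, with the convention \<open>exp (-\<infinity>) = 0\<close> for \<open>k = \<infinity>\<close>.\<close>

definition gibbs :: "real \<Rightarrow> real \<Rightarrow> ennreal \<Rightarrow> real" where
  "gibbs \<epsilon> t k = (if k = \<infinity> then 0 else exp ((t - enn2real k) / \<epsilon>))"

text \<open>
  The exponential term is a Lebesgue integral in \<open>[0, \<infinity>]\<close>; when it is infinite, the functional
  is \<open>-\<infinity>\<close>.
\<close>

definition entropic_dual ::
  "nat \<Rightarrow> (nat \<Rightarrow> 'a measure) \<Rightarrow> ((nat \<Rightarrow> 'a) \<Rightarrow> ennreal) \<Rightarrow> real \<Rightarrow> (nat \<Rightarrow> 'a \<Rightarrow> real) \<Rightarrow> ereal" where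
  "entropic_dual N \<rho> c \<epsilon> u =
     ereal (\<Sum>i\<in>{1..N}. \<integral>x. u i x \<partial>\<rho> i)
     - ereal \<epsilon> * enn2ereal (\<integral>\<^sup>+x. ennreal (gibbs \<epsilon> (\<Sum>i\<in>{1..N}. u i (x i)) (c x)) \<partial>Pi\<^sub>M {1..N} \<rho>)
     + ereal \<epsilon>"

text \<open>
  The transform in the \<open>i\<close>-th variable; it does not depend on \<open>u i\<close>. It is real-valued, so it
  renders the paper's formula where the integral lies in \<open>(0, \<infinity>)\<close>. This is the case at every
  point of the \<open>i\<close>-th space whenever the functions \<open>u j\<close> are bounded and measurable and
  \<open>c\<close> has a finite integral in the remaining variables.
\<close>

definition c_eps_transform ::
  "nat \<Rightarrow> (nat \<Rightarrow> 'a measure) \<Rightarrow> ((nat \<Rightarrow> 'a) \<Rightarrow> ennreal) \<Rightarrow> real \<Rightarrow> nat \<Rightarrow>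
   (nat \<Rightarrow> 'a \<Rightarrow> real) \<Rightarrow> 'a \<Rightarrow> real" where
  "c_eps_transform N \<rho> c \<epsilon> i u x =
     - \<epsilon> * ln (\<integral>y. gibbs \<epsilon> (\<Sum>j\<in>{1..N} - {i}. u j (y j)) (c (y(i := x))) \<partial>Pi\<^sub>M ({1..N} - {i}) \<rho>)"

definition L1_tuple :: "nat \<Rightarrow> (nat \<Rightarrow> 'a measure) \<Rightarrow> (nat \<Rightarrow> 'a \<Rightarrow> real) \<Rightarrow> bool" where
  "L1_tuple N \<rho> u \<longleftrightarrow> (\<forall>i\<in>{1..N}. integrable (\<rho> i) (u i))"

definition dual_maximizer ::
  "nat \<Rightarrow> (nat \<Rightarrow> 'a measure) \<Rightarrow> ((nat \<Rightarrow> 'a) \<Rightarrow> ennreal) \<Rightarrow> real \<Rightarrow> (nat \<Rightarrow> 'a \<Rightarrow> real) \<Rightarrow> bool" where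
  "dual_maximizer N \<rho> c \<epsilon> u \<longleftrightarrow> is_arg_max (entropic_dual N \<rho> c \<epsilon>) (L1_tuple N \<rho>) u"

end

(*
  Put f i = u i / eps and k = exp (- c / eps). Updating one coordinate by the transform makes
  the i-th marginal of the density exp (sum f) k equal to one, and raises the dual functional by
  at least a multiple of the squared L2 norm of the change. Jensen's inequality keeps all iterates
  in a class on which sum f is bounded by a fixed constant. Two slices of k always overlap in mass
  at least exp (- 2 K / eps), so the weighted L2 norm of a sum of one-variable functions controls
  the variance of each summand. Hence the functional is strongly concave modulo constants, the
  remaining gain is bounded by a multiple of the gain of the next sweep, and the values converge
  geometrically. Since the logarithm of a marginal depends on the other coordinates only through
  averages, small L2 increments force uniformly small increments in the following sweep; the
  iterates therefore converge uniformly, and at the limit all marginals are one, which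
  characterizes the maximizers.
*)
theory Submission
  imports Defs
begin

section \<open>Elementary inequalities\<close>

text \<open>The cost is only lower semicontinuous and may be infinite. Hence no modulus of
  continuity for the iterates is at hand, and the kernel may vanish on large sets, so it cannot be
  bounded below pointwise. What remains is the bound on the slice integrals of the cost. Jensen
  turns it into a lower bound for slices of \<open>exp (off f i) * k\<close> that sees the other
  coordinates only through their means. The product of two slices of \<open>k\<close> is the slice
  of the kernel of a sum of two costs, whose integral is at most \<open>2 * K\<close>; this is the
  source of the overlap bound. No maximizer is presupposed: the gap estimate compares one iterate
  with every other one, and the maximizer is built as the limit. Gap and next sweep are linked
  because the \<open>i\<close>-th marginal just before its update equals \<open>exp\<close> of minus
  the increment, so marginal defects and increments are one quantity up to the effect of earlier
  updates in the sweep. Constants of zero sum are invisible to the functional, so estimates concern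
  \<open>tot f\<close> and deviations from means.\<close>

lemma exp_ge_quadratic:
  fixes t T :: real
  assumes "\<bar>t\<bar> \<le> T"
  shows "1 + t + exp (- T) * t\<^sup>2 / 2 \<le> exp t"
proof -
  obtain s where s: "\<bar>s\<bar> \<le> \<bar>t\<bar>" "exp t = (\<Sum>m<2. t ^ m / fact m) + exp s / fact 2 * t ^ 2"
    using Maclaurin_exp_le[of t 2] by blast
  have "exp (- T) * t\<^sup>2 \<le> exp s * t\<^sup>2"
    using s(1) assms by (intro mult_right_mono) auto
  then show ?thesis
    using s(2) by (simp add: numeral_2_eq_2 power2_eq_square)
qed

lemma abs_exp_diff_le:
  fixes a b R :: real
  assumes "a \<le> R" "b \<le> R"
  shows "\<bar>exp a - exp b\<bar> \<le> exp R * \<bar>a - b\<bar>"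
proof -
  have aux: "exp y - exp x \<le> exp R * (y - x)" if "x \<le> y" "y \<le> R" for x y :: real
  proof -
    have "exp y - exp x = exp y * (1 - exp (x - y))"
      by (simp add: algebra_simps flip: exp_add)
    also have "\<dots> \<le> exp y * (y - x)"
      using exp_ge_add_one_self[of "x - y"] by (intro mult_left_mono) (linarith, simp)
    also have "\<dots> \<le> exp R * (y - x)"
      using that by (intro mult_right_mono) auto
    finally show ?thesis .
  qed
  show ?thesis
  proof (cases "a \<le> b")
    case True
    then have "exp a \<le> exp b" by simp
    then show ?thesis using aux[OF True assms(2)] True by (simp add: abs_if)
  next
    case False
    then have "exp b \<le> exp a" "b \<le> a" by auto
    then show ?thesis using aux[of b a] assms False by (simp add: abs_if)
  qed
qed

text \<open>Converse of the Lipschitz bound for \<open>exp\<close>: a marginal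
  \<open>exp (- D)\<close> close to one forces a small increment \<open>D\<close>.\<close>

lemma abs_le_exp_diff_one:
  fixes D T :: real
  assumes "\<bar>D\<bar> \<le> T"
  shows "\<bar>D\<bar> \<le> exp T * \<bar>1 - exp (- D)\<bar>"
proof (cases "D \<ge> 0")
  case True
  have "D \<le> exp D - 1"
    using exp_ge_add_one_self[of D] by linarith
  also have "\<dots> = exp D * (1 - exp (- D))"
    by (simp add: algebra_simps flip: exp_add)
  also have "\<dots> \<le> exp T * (1 - exp (- D))"
    using assms True by (intro mult_right_mono) auto
  finally show ?thesis using True by simp
next
  case False
  have "- D \<le> 1 * (exp (- D) - 1)"
    using exp_ge_add_one_self[of "- D"] by simp
  also have "\<dots> \<le> exp T * (exp (- D) - 1)"
    using assms False by (intro mult_right_mono) auto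
  finally show ?thesis using False by (simp add: abs_if)
qed

text \<open>The gap bound is uniform in \<open>m\<close>, which plays the part of infinity: each
  step removes the fraction \<open>1 / C'\<close> of every remainder, without reference to a limit
  of \<open>g\<close>. The increments are the remainders with \<open>m = Suc n\<close>.\<close>

lemma geometric_increments:
  fixes g :: "nat \<Rightarrow> real"
  assumes mono: "\<And>n. g n \<le> g (Suc n)"
    and gap: "\<And>m n. g m - g n \<le> C * (g (Suc n) - g n)"
  obtains B q where "0 \<le> B" "0 < q" "q < 1" "\<And>n. g (Suc n) - g n \<le> B * q ^ n"
proof -
  \<comment> \<open>The maximum with 2 keeps \<open>q = 1 - 1 / C'\<close> strictly between 0 and 1
    whatever \<open>C\<close> is; the gap bound survives since \<open>g\<close> is monotone.\<close>
  define C' where "C' = max C 2"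
  have gap': "g m - g n \<le> C' * (g (Suc n) - g n)" for m n
    using gap[of m n] mult_right_mono[of C C' "g (Suc n) - g n"] mono[of n]
    unfolding C'_def by force
  define q where "q = 1 - 1 / C'"
  have C': "C' \<ge> 2" by (simp add: C'_def)
  have q: "0 < q" "q < 1" using C' by (auto simp: q_def field_simps)
  define B where "B = C' * (g 1 - g 0)"
  have B: "B \<ge> 0" using C' mono[of 0] by (simp add: B_def)
  have rem: "g m - g n \<le> B * q ^ n" for m n
  proof (induction n)
    case 0 show ?case using gap'[of m 0] by (simp add: B_def)
  next
    case (Suc n)
    have "(g m - g n) / C' \<le> g (Suc n) - g n"
      using gap'[of m n] C' by (simp add: field_simps)
    moreover have "q * (g m - g n) = (g m - g n) - (g m - g n) / C'"
      by (simp add: q_def left_diff_distrib)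
    ultimately have "g m - g (Suc n) \<le> q * (g m - g n)" by linarith
    also have "\<dots> \<le> q * (B * q ^ n)"
      using Suc q by (intro mult_left_mono) auto
    finally show ?case by (simp add: mult_ac)
  qed
  show ?thesis by (rule that[OF B q rem])
qed

section \<open>Bounded kernels on finite products of probability spaces\<close>

text \<open>The cost enters only through these properties, with \<open>L\<close> standing for
  \<open>K / \<epsilon>\<close>. In \<open>slice_lower\<close> the exponent \<open>b\<close> will be
  the sum of the other coordinates. A separate \<open>overlap\<close> is required because two slices
  of positive mass could still be disjoint.\<close>

locale gibbs_kernel =
  fixes I :: "'i set" and Q :: "'i \<Rightarrow> 'a measure" and k :: "('i \<Rightarrow> 'a) \<Rightarrow> real" and L :: real
  assumes finite_I: "finite I" and I_nonempty: "I \<noteq> {}"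
    and prob_Q: "\<And>i. i \<in> I \<Longrightarrow> prob_space (Q i)"
    and k_measurable [measurable]: "k \<in> borel_measurable (Pi\<^sub>M I Q)"
    and k_nonneg: "\<And>y. y \<in> space (Pi\<^sub>M I Q) \<Longrightarrow> 0 \<le> k y"
    and k_le_1: "\<And>y. y \<in> space (Pi\<^sub>M I Q) \<Longrightarrow> k y \<le> 1"
    and slice_lower: "\<And>i x b B. i \<in> I \<Longrightarrow> x \<in> space (Q i) \<Longrightarrow>
          b \<in> borel_measurable (Pi\<^sub>M (I - {i}) Q) \<Longrightarrow>
          (\<And>y. y \<in> space (Pi\<^sub>M (I - {i}) Q) \<Longrightarrow> \<bar>b y\<bar> \<le> B) \<Longrightarrow>
          exp ((\<integral>y. b y \<partial>Pi\<^sub>M (I - {i}) Q) - L) \<le> (\<integral>y. exp (b y) * k (y(i := x)) \<partial>Pi\<^sub>M (I - {i}) Q)"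
    and overlap: "\<And>i x x'. i \<in> I \<Longrightarrow> x \<in> space (Q i) \<Longrightarrow> x' \<in> space (Q i) \<Longrightarrow>
          exp (- 2 * L) \<le> (\<integral>y. k (y(i := x)) * k (y(i := x')) \<partial>Pi\<^sub>M (I - {i}) Q)"
begin

section \<open>Inserting one coordinate: Fubini on finite products\<close>

abbreviation "P \<equiv> Pi\<^sub>M I Q"
abbreviation "P' i \<equiv> Pi\<^sub>M (I - {i}) Q"

lemma prob_P: "prob_space P"
  by (intro prob_space_PiM prob_Q)

lemma prob_P': "prob_space (P' i)"
  by (intro prob_space_PiM prob_Q) auto

lemma pair_prob: "i \<in> I \<Longrightarrow> pair_prob_space (Q i) (P' i)"
  using prob_Q prob_P' by (intro pair_prob_space.intro pair_sigma_finite.intro)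
    (auto simp: prob_space_imp_sigma_finite)

lemma insert_coord_measurable [measurable]:
  assumes "i \<in> I"
  shows "(\<lambda>(x, y). y(i := x)) \<in> Q i \<Otimes>\<^sub>M P' i \<rightarrow>\<^sub>M P"
proof -
  have "(\<lambda>z. (snd z)(i := fst z)) \<in> Q i \<Otimes>\<^sub>M P' i \<rightarrow>\<^sub>M P"
    using assms by (intro measurable_fun_upd[where J = "I - {i}"]) auto
  then show ?thesis by (simp add: case_prod_beta')
qed

lemma insert_coord_measurable' [measurable]:
  "i \<in> I \<Longrightarrow> x \<in> space (Q i) \<Longrightarrow> (\<lambda>y. y(i := x)) \<in> P' i \<rightarrow>\<^sub>M P"
  by (intro measurable_fun_upd[where J = "I - {i}"]) auto

lemma insert_coord_space:
  "i \<in> I \<Longrightarrow> x \<in> space (Q i) \<Longrightarrow> y \<in> space (P' i) \<Longrightarrow> y(i := x) \<in> space P"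
  by (rule measurable_space[OF insert_coord_measurable'])

text \<open>All Fubini statements below are transported along this image measure.\<close>

lemma distr_insert_coord:
  assumes "i \<in> I"
  shows "distr (Q i \<Otimes>\<^sub>M P' i) P (\<lambda>(x, y). y(i := x)) = P"
  using distr_pair_PiM_eq_PiM[of "I - {i}" Q i] prob_Q assms by (simp add: insert_absorb)

lemma nn_fubini:
  assumes i: "i \<in> I" and F[measurable]: "F \<in> borel_measurable P"
  shows "(\<integral>\<^sup>+ y. F y \<partial>P) = (\<integral>\<^sup>+ x. \<integral>\<^sup>+ y. F (y(i := x)) \<partial>P' i \<partial>Q i)"
proof -
  interpret pair_prob_space "Q i" "P' i" by (rule pair_prob[OF i])
  note [measurable] = insert_coord_measurable[OF i]
  have "(\<integral>\<^sup>+ y. F y \<partial>P) = (\<integral>\<^sup>+ y. F y \<partial>distr (Q i \<Otimes>\<^sub>M P' i) P (\<lambda>(x, y). y(i := x)))"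
    by (simp add: distr_insert_coord[OF i])
  also have "\<dots> = (\<integral>\<^sup>+ z. F ((snd z)(i := fst z)) \<partial>(Q i \<Otimes>\<^sub>M P' i))"
    by (subst nn_integral_distr) (auto simp: case_prod_beta' i)
  also have "\<dots> = (\<integral>\<^sup>+ x. \<integral>\<^sup>+ y. F (y(i := x)) \<partial>P' i \<partial>Q i)"
    by (subst M2.nn_integral_fst[symmetric])
       (use measurable_compose[OF insert_coord_measurable[OF i] F] in \<open>auto simp: case_prod_beta'\<close>)
  finally show ?thesis .
qed

lemma nn_fubini_measurable:
  assumes i: "i \<in> I" and F[measurable]: "F \<in> borel_measurable P"
  shows "(\<lambda>x. \<integral>\<^sup>+ y. F (y(i := x)) \<partial>P' i) \<in> borel_measurable (Q i)"
proof -
  interpret pair_prob_space "Q i" "P' i" by (rule pair_prob[OF i])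
  show ?thesis
    using M2.borel_measurable_nn_integral[of "\<lambda>x y. F (y(i := x))" "Q i"]
      measurable_compose[OF insert_coord_measurable[OF i] F] by (simp add: case_prod_beta')
qed

lemma fubini:
  fixes F :: "_ \<Rightarrow> real"
  assumes i: "i \<in> I" and F: "integrable P F"
  shows "integrable (Q i) (\<lambda>x. \<integral>y. F (y(i := x)) \<partial>P' i)"
    and "(\<integral>y. F y \<partial>P) = (\<integral>x. \<integral>y. F (y(i := x)) \<partial>P' i \<partial>Q i)"
proof -
  interpret pair_prob_space "Q i" "P' i" by (rule pair_prob[OF i])
  note [measurable] = insert_coord_measurable[OF i] 
  have Fm[measurable]: "F \<in> borel_measurable P" using F by auto
  have int: "integrable (Q i \<Otimes>\<^sub>M P' i) (\<lambda>(x, y). F (y(i := x)))"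
    using F integrable_distr_eq[OF insert_coord_measurable[OF i], of F] distr_insert_coord[OF i]
    by (simp add: case_prod_beta')
  show "integrable (Q i) (\<lambda>x. \<integral>y. F (y(i := x)) \<partial>P' i)"
    using integrable_fst'[OF int] by simp
  have "(\<integral>y. F y \<partial>P) = (\<integral>y. F y \<partial>distr (Q i \<Otimes>\<^sub>M P' i) P (\<lambda>(x, y). y(i := x)))"
    by (simp add: distr_insert_coord[OF i])
  also have "\<dots> = (\<integral>z. F ((snd z)(i := fst z)) \<partial>(Q i \<Otimes>\<^sub>M P' i))"
    by (subst integral_distr) (auto simp: case_prod_beta' i)
  also have "\<dots> = (\<integral>x. \<integral>y. F (y(i := x)) \<partial>P' i \<partial>Q i)"
    using integral_fst'[OF int] by (simp add: case_prod_beta')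
  finally show "(\<integral>y. F y \<partial>P) = (\<integral>x. \<integral>y. F (y(i := x)) \<partial>P' i \<partial>Q i)" .
qed

lemma fubini_measurable:
  fixes F :: "_ \<Rightarrow> real"
  assumes i: "i \<in> I" and F[measurable]: "F \<in> borel_measurable P"
  shows "(\<lambda>x. \<integral>y. F (y(i := x)) \<partial>P' i) \<in> borel_measurable (Q i)"
proof -
  interpret pair_prob_space "Q i" "P' i" by (rule pair_prob[OF i])
  show ?thesis
    using M2.borel_measurable_lebesgue_integral[of "\<lambda>x y. F (y(i := x))" "Q i"]
      measurable_compose[OF insert_coord_measurable[OF i] F] by (simp add: case_prod_beta')
qed

lemma integrable_bounded_P:
  fixes F :: "_ \<Rightarrow> real"
  assumes "F \<in> borel_measurable P" "\<And>y. y \<in> space P \<Longrightarrow> \<bar>F y\<bar> \<le> B"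
  shows "integrable P F"
proof -
  interpret prob_space P by (rule prob_P)
  show ?thesis using assms by (intro integrable_const_bound[where B = B]) auto
qed

lemma integrable_bounded_P':
  fixes F :: "_ \<Rightarrow> real"
  assumes "F \<in> borel_measurable (P' i)" "\<And>y. y \<in> space (P' i) \<Longrightarrow> \<bar>F y\<bar> \<le> B"
  shows "integrable (P' i) F"
proof -
  interpret prob_space "P' i" by (rule prob_P')
  show ?thesis using assms by (intro integrable_const_bound[where B = B]) auto
qed

lemma integrable_bounded_Q:
  fixes F :: "_ \<Rightarrow> real"
  assumes "i \<in> I" "F \<in> borel_measurable (Q i)" "\<And>x. x \<in> space (Q i) \<Longrightarrow> \<bar>F x\<bar> \<le> B"
  shows "integrable (Q i) F"
proof -
  interpret prob_space "Q i" by (rule prob_Q[OF assms(1)])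
  show ?thesis using assms by (intro integrable_const_bound[where B = B]) auto
qed

text \<open>Stated for a subset \<open>J\<close> of \<open>I\<close> so that it serves both
  \<open>P\<close> and the products \<open>P' i\<close>.\<close>

lemma integral_component:
  fixes h :: "'a \<Rightarrow> real"
  assumes "J \<subseteq> I" "j \<in> J" "h \<in> borel_measurable (Q j)"
  shows "(\<integral>y. h (y j) \<partial>Pi\<^sub>M J Q) = (\<integral>x. h x \<partial>Q j)"
proof -
  have d: "distr (Pi\<^sub>M J Q) (Q j) (\<lambda>\<omega>. \<omega> j) = Q j"
    by (rule distr_PiM_component) (use assms prob_Q in auto)
  have "(\<integral>x. h x \<partial>Q j) = (\<integral>x. h x \<partial>distr (Pi\<^sub>M J Q) (Q j) (\<lambda>\<omega>. \<omega> j))"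
    by (simp add: d)
  also have "\<dots> = (\<integral>y. h (y j) \<partial>Pi\<^sub>M J Q)"
    using assms by (intro integral_distr) auto
  finally show ?thesis by simp
qed

lemma integrable_component:
  fixes h :: "'a \<Rightarrow> real"
  assumes "J \<subseteq> I" "j \<in> J" "integrable (Q j) h"
  shows "integrable (Pi\<^sub>M J Q) (\<lambda>y. h (y j))"
proof -
  have d: "distr (Pi\<^sub>M J Q) (Q j) (\<lambda>\<omega>. \<omega> j) = Q j"
    by (rule distr_PiM_component) (use assms prob_Q in auto)
  show ?thesis
    using integrable_distr[of "\<lambda>\<omega>. \<omega> j" "Pi\<^sub>M J Q" "Q j" h] assms d by simp
qed

section \<open>Tuples of potentials, their densities and marginals\<close>

definition tot :: "('i \<Rightarrow> 'a \<Rightarrow> real) \<Rightarrow> ('i \<Rightarrow> 'a) \<Rightarrow> real" where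
  "tot f y = (\<Sum>j\<in>I. f j (y j))"

definition dens :: "('i \<Rightarrow> 'a \<Rightarrow> real) \<Rightarrow> ('i \<Rightarrow> 'a) \<Rightarrow> real" where
  "dens f y = exp (tot f y) * k y"

text \<open>The density with respect to \<open>Q i\<close> of the \<open>i\<close>-th marginal of
  the measure that has density \<open>dens f\<close> with respect to \<open>P\<close>.\<close>

definition marg :: "('i \<Rightarrow> 'a \<Rightarrow> real) \<Rightarrow> 'i \<Rightarrow> 'a \<Rightarrow> real" where
  "marg f i x = (\<integral>y. dens f (y(i := x)) \<partial>P' i)"

text \<open>The entropic dual functional divided by eps, at the potentials eps times
  \<open>f\<close>. Being built from Bochner integrals, it has this meaning only for integrable
  \<open>dens f\<close>; the value \<open>-\<infinity>\<close> is treated separately.\<close>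

definition dual :: "('i \<Rightarrow> 'a \<Rightarrow> real) \<Rightarrow> real" where
  "dual f = (\<Sum>i\<in>I. \<integral>x. f i x \<partial>Q i) - (\<integral>y. dens f y \<partial>P) + 1"


text \<open>The bound concerns the sum only, since constants adding up to zero can be moved between
  coordinates without changing \<open>dens f\<close>.\<close>

definition tot_bounded :: "real \<Rightarrow> ('i \<Rightarrow> 'a \<Rightarrow> real) \<Rightarrow> bool" where
  "tot_bounded R f \<longleftrightarrow>
     (\<forall>i\<in>I. f i \<in> borel_measurable (Q i)) \<and> (\<forall>y\<in>space P. \<bar>tot f y\<bar> \<le> R)"

definition off :: "('i \<Rightarrow> 'a \<Rightarrow> real) \<Rightarrow> 'i \<Rightarrow> ('i \<Rightarrow> 'a) \<Rightarrow> real" where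
  "off f i y = (\<Sum>j\<in>I - {i}. f j (y j))"

definition mean :: "('i \<Rightarrow> 'a \<Rightarrow> real) \<Rightarrow> 'i \<Rightarrow> real" where
  "mean f i = (\<integral>x. f i x \<partial>Q i)"

text \<open>The integral under the logarithm of the transform, for potentials divided by eps. It
  ignores \<open>f i\<close>.\<close>

definition partition_fn :: "('i \<Rightarrow> 'a \<Rightarrow> real) \<Rightarrow> 'i \<Rightarrow> 'a \<Rightarrow> real" where
  "partition_fn f i x = (\<integral>y. exp (off f i y) * k (y(i := x)) \<partial>P' i)"

definition step :: "('i \<Rightarrow> 'a \<Rightarrow> real) \<Rightarrow> 'i \<Rightarrow> 'i \<Rightarrow> 'a \<Rightarrow> real" where
  "step f i = f(i := \<lambda>x. - ln (partition_fn f i x))"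

lemma tot_insert: "i \<in> I \<Longrightarrow> tot f (y(i := x)) = f i x + off f i y"
  unfolding tot_def off_def by (subst sum.remove[OF finite_I]) (auto intro!: sum.cong)

lemma tot_measurable [measurable (raw)]:
  "(\<And>i. i \<in> I \<Longrightarrow> f i \<in> borel_measurable (Q i)) \<Longrightarrow> tot f \<in> borel_measurable P"
  unfolding tot_def[abs_def]
  by (intro borel_measurable_sum measurable_compose[OF measurable_component_singleton]) auto

lemma off_measurable:
  "(\<And>i. i \<in> I \<Longrightarrow> f i \<in> borel_measurable (Q i)) \<Longrightarrow> off f i \<in> borel_measurable (P' i)"
  unfolding off_def[abs_def]
  by (intro borel_measurable_sum measurable_compose[OF measurable_component_singleton]) auto

lemma dens_measurable:
  "(\<And>i. i \<in> I \<Longrightarrow> f i \<in> borel_measurable (Q i)) \<Longrightarrow> dens f \<in> borel_measurable P"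
  unfolding dens_def[abs_def]
  by (intro borel_measurable_times measurable_compose[OF _ borel_measurable_exp] tot_measurable
    k_measurable)

lemma dens_nonneg: "y \<in> space P \<Longrightarrow> 0 \<le> dens f y"
  unfolding dens_def using k_nonneg by simp

lemma space_Q_nonempty: "i \<in> I \<Longrightarrow> space (Q i) \<noteq> {}"
  by (rule prob_space.not_empty[OF prob_Q])

lemma space_P'_nonempty: "space (P' i) \<noteq> {}"
  by (rule prob_space.not_empty[OF prob_P'])

lemma component_space: "y \<in> space P \<Longrightarrow> i \<in> I \<Longrightarrow> y i \<in> space (Q i)"
  by (auto simp: space_PiM)

lemma tot_boundedD:
  assumes "tot_bounded R f"
  shows "i \<in> I \<Longrightarrow> f i \<in> borel_measurable (Q i)" "y \<in> space P \<Longrightarrow> \<bar>tot f y\<bar> \<le> R"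
  using assms by (auto simp: tot_bounded_def)

text \<open>Freezing the other coordinates at one point turns the bound on the sum into one on
  \<open>f i\<close>. This bound depends on \<open>f\<close>, so it only serves
  integrability.\<close>

lemma tot_bounded_component:
  assumes "tot_bounded R f" "i \<in> I"
  obtains B where "\<And>x. x \<in> space (Q i) \<Longrightarrow> \<bar>f i x\<bar> \<le> B"
proof -
  obtain y where y: "y \<in> space (P' i)" using space_P'_nonempty by blast
  have "\<bar>f i x\<bar> \<le> R + \<bar>off f i y\<bar>" if "x \<in> space (Q i)" for x
    using tot_boundedD(2)[OF assms(1) insert_coord_space[OF assms(2) that y]]
    by (simp add: tot_insert assms(2))
  then show ?thesis by (rule that)
qed

lemma tot_boundedI:
  assumes "\<And>i. i \<in> I \<Longrightarrow> f i \<in> borel_measurable (Q i)"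
    and "\<And>i. i \<in> I \<Longrightarrow> \<exists>B. \<forall>x\<in>space (Q i). \<bar>f i x\<bar> \<le> B"
  obtains R where "tot_bounded R f"
proof -
  obtain B where B: "\<And>i x. i \<in> I \<Longrightarrow> x \<in> space (Q i) \<Longrightarrow> \<bar>f i x\<bar> \<le> B i"
    using assms(2) by metis
  have "\<bar>tot f y\<bar> \<le> (\<Sum>i\<in>I. B i)" if "y \<in> space P" for y
    unfolding tot_def using B component_space[OF that]
    by (intro order_trans[OF sum_abs] sum_mono) auto
  then show ?thesis using assms(1) by (intro that[of "\<Sum>i\<in>I. B i"]) (auto simp: tot_bounded_def)
qed

lemma tot_bounded_integrable:
  assumes "tot_bounded R f" "i \<in> I"
  shows "integrable (Q i) (f i)"
proof -
  obtain B where "\<And>x. x \<in> space (Q i) \<Longrightarrow> \<bar>f i x\<bar> \<le> B"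
    using tot_bounded_component[OF assms] by blast
  then show ?thesis
    by (intro integrable_bounded_Q assms tot_boundedD(1)[OF assms(1)])
qed

lemma tot_bounded_upd:
  assumes "tot_bounded R f" "h \<in> borel_measurable (Q i)" "\<And>x. x \<in> space (Q i) \<Longrightarrow> \<bar>h x\<bar> \<le> B"
  obtains R' where "tot_bounded R' (f(i := h))"
proof (rule tot_boundedI[of "f(i := h)"])
  show "(f(i := h)) j \<in> borel_measurable (Q j)" if "j \<in> I" for j
    using assms that by (auto dest: tot_boundedD)
  show "\<exists>B. \<forall>x\<in>space (Q j). \<bar>(f(i := h)) j x\<bar> \<le> B" if "j \<in> I" for j
    using assms(3) tot_bounded_component[OF assms(1) that] by (cases "j = i") (simp, blast, simp, metis)
qed (rule that)

lemma dens_le: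
  assumes "tot_bounded R f" "y \<in> space P"
  shows "dens f y \<le> exp R"
proof -
  have "exp (tot f y) * k y \<le> exp R * 1"
    using tot_boundedD(2)[OF assms] k_nonneg[OF assms(2)] k_le_1[OF assms(2)]
    by (intro mult_mono) auto
  then show ?thesis by (simp add: dens_def)
qed

lemma dens_ge:
  assumes "tot_bounded R f" "y \<in> space P"
  shows "exp (- R) * k y \<le> dens f y"
  unfolding dens_def using tot_boundedD(2)[OF assms] k_nonneg[OF assms(2)]
  by (intro mult_right_mono) auto

lemma dens_integrable:
  assumes "tot_bounded R f"
  shows "integrable P (dens f)"
  using assms dens_le dens_nonneg
  by (intro integrable_bounded_P[where B = "exp R"] dens_measurable) (auto dest: tot_boundedD)

lemma slice_integrable:
  fixes F :: "_ \<Rightarrow> real"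
  assumes "i \<in> I" "x \<in> space (Q i)" "F \<in> borel_measurable P" "\<And>y. y \<in> space P \<Longrightarrow> \<bar>F y\<bar> \<le> B"
  shows "integrable (P' i) (\<lambda>y. F (y(i := x)))"
  using assms insert_coord_space[OF assms(1,2)]
  by (intro integrable_bounded_P' measurable_compose[OF insert_coord_measurable']) auto

lemma dens_slice_integrable:
  assumes "tot_bounded R f" "i \<in> I" "x \<in> space (Q i)"
  shows "integrable (P' i) (\<lambda>y. dens f (y(i := x)))"
  using assms dens_le dens_nonneg
  by (intro slice_integrable[where B = "exp R"] dens_measurable) (auto dest: tot_boundedD)

lemma marg_measurable:
  assumes "\<And>i. i \<in> I \<Longrightarrow> f i \<in> borel_measurable (Q i)" "i \<in> I"
  shows "marg f i \<in> borel_measurable (Q i)"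
  unfolding marg_def[abs_def] by (intro fubini_measurable dens_measurable assms)

text \<open>Zeroing coordinate \<open>i\<close> exhibits the function as a marginal, from which it
  inherits measurability.\<close>

lemma partition_fn_eq_marg:
  assumes "i \<in> I"
  shows "partition_fn f i = marg (f(i := \<lambda>_. 0)) i"
proof -
  have "off (f(i := \<lambda>_. 0)) i = off f i"
    by (auto simp: off_def intro!: sum.cong)
  then show ?thesis
    by (simp add: fun_eq_iff partition_fn_def marg_def dens_def tot_insert assms)
qed

lemma marg_eq_partition_fn:
  assumes "i \<in> I"
  shows "marg f i x = exp (f i x) * partition_fn f i x"
  by (simp add: partition_fn_def marg_def dens_def tot_insert assms exp_add mult.assoc)

lemma partition_fn_measurable:
  assumes "\<And>i. i \<in> I \<Longrightarrow> f i \<in> borel_measurable (Q i)" "i \<in> I"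
  shows "partition_fn f i \<in> borel_measurable (Q i)"
  unfolding partition_fn_eq_marg[OF assms(2)] using assms by (intro marg_measurable) auto

section \<open>Bounds on the partition functions\<close>

lemma integral_off:
  assumes "\<And>j. j \<in> I \<Longrightarrow> integrable (Q j) (f j)"
  shows "(\<integral>y. off f i y \<partial>P' i) = (\<Sum>j\<in>I - {i}. mean f j)"
proof -
  have "(\<integral>y. off f i y \<partial>P' i) = (\<Sum>j\<in>I - {i}. \<integral>y. f j (y j) \<partial>P' i)"
    unfolding off_def using assms by (intro Bochner_Integration.integral_sum integrable_component) auto
  also have "\<dots> = (\<Sum>j\<in>I - {i}. mean f j)"
    unfolding mean_def using assms by (intro sum.cong integral_component) auto
  finally show ?thesis .
qed

lemma off_bounded:
  assumes "tot_bounded R f" "i \<in> I"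
  obtains B where "\<And>y. y \<in> space (P' i) \<Longrightarrow> \<bar>off f i y\<bar> \<le> B"
proof -
  obtain x where x: "x \<in> space (Q i)" using space_Q_nonempty[OF assms(2)] by blast
  have "\<bar>off f i y\<bar> \<le> R + \<bar>f i x\<bar>" if "y \<in> space (P' i)" for y
    using tot_boundedD(2)[OF assms(1) insert_coord_space[OF assms(2) x that]]
    by (simp add: tot_insert assms(2))
  then show ?thesis by (rule that)
qed

text \<open>Jensen with exponent \<open>off f i\<close>: the other coordinates enter through their
  means and not through sup norms, which is what allows bounds that do not deteriorate along the
  iteration.\<close>

lemma partition_fn_ge:
  assumes "tot_bounded R f" "i \<in> I" "x \<in> space (Q i)"
  shows "exp ((\<Sum>j\<in>I - {i}. mean f j) - L) \<le> partition_fn f i x"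
proof -
  obtain B where B: "\<And>y. y \<in> space (P' i) \<Longrightarrow> \<bar>off f i y\<bar> \<le> B"
    using off_bounded[OF assms(1,2)] by blast
  show ?thesis
    using slice_lower[OF assms(2,3) off_measurable B] assms tot_bounded_integrable[OF assms(1)]
    by (simp add: integral_off partition_fn_def tot_boundedD)
qed

lemma partition_fn_pos:
  assumes "tot_bounded R f" "i \<in> I" "x \<in> space (Q i)"
  shows "0 < partition_fn f i x"
  using partition_fn_ge[OF assms] exp_gt_zero order_less_le_trans by blast

lemma partition_fn_le:
  assumes f: "tot_bounded R f" and i: "i \<in> I" and x: "x \<in> space (Q i)"
    and B: "\<And>y. y \<in> space (P' i) \<Longrightarrow> off f i y \<le> B"
  shows "partition_fn f i x \<le> exp B"
proof -
  interpret prob_space "P' i" by (rule prob_P')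
  have le: "exp (off f i y) * k (y(i := x)) \<le> exp B" if "y \<in> space (P' i)" for y
  proof -
    have "exp (off f i y) * k (y(i := x)) \<le> exp B * 1"
      using B[OF that] k_nonneg k_le_1 insert_coord_space[OF i x that] by (intro mult_mono) auto
    then show ?thesis by simp
  qed
  have "integrable (P' i) (\<lambda>y. exp (off f i y) * k (y(i := x)))"
    using le k_nonneg insert_coord_space[OF i x] tot_boundedD[OF f] off_measurable[of f i]
    by (intro integrable_bounded_P'[where B = "exp B"] borel_measurable_times
      measurable_compose[OF insert_coord_measurable' k_measurable] i x
      measurable_compose[OF _ borel_measurable_exp])
      auto
  then have "partition_fn f i x \<le> (\<integral>y. exp B \<partial>P' i)"
    unfolding partition_fn_def using le by (intro integral_mono) auto
  then show ?thesis by (simp add: prob_space)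
qed

section \<open>Effect of updating one coordinate\<close>

lemma step_other [simp]: "j \<noteq> i \<Longrightarrow> step f i j = f j"
  by (simp add: step_def)

lemma marg_step:
  assumes "tot_bounded R f" "i \<in> I" "x \<in> space (Q i)"
  shows "marg (step f i) i x = 1"
proof -
  have "partition_fn (step f i) i = partition_fn f i"
    by (simp add: fun_eq_iff partition_fn_def off_def step_def)
  then show ?thesis
    using partition_fn_pos[OF assms]
    by (simp add: marg_eq_partition_fn assms(2) step_def exp_minus)
qed

text \<open>The radius found here depends on \<open>f\<close>; it only makes the update accessible
  to the integral estimates until \<open>admissible\<close> supplies a uniform one.\<close>

lemma step_tot_bounded:
  assumes f: "tot_bounded R f" and i: "i \<in> I"
  obtains R' where "tot_bounded R' (step f i)"
proof -
  obtain B where B: "\<And>y. y \<in> space (P' i) \<Longrightarrow> \<bar>off f i y\<bar> \<le> B"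
    using off_bounded[OF assms] by blast
  define M where "M = (\<Sum>j\<in>I - {i}. mean f j) - L"
  have "\<bar>- ln (partition_fn f i x)\<bar> \<le> max \<bar>M\<bar> B" if x: "x \<in> space (Q i)" for x
  proof -
    have p: "0 < partition_fn f i x" by (rule partition_fn_pos[OF f i x])
    have "partition_fn f i x \<le> exp B"
      using B by (intro partition_fn_le[OF f i x]) (auto dest!: abs_le_D1)
    then have "ln (partition_fn f i x) \<le> B"
      using p by (metis ln_exp ln_le_cancel_iff exp_gt_zero)
    moreover have "M \<le> ln (partition_fn f i x)"
      using partition_fn_ge[OF f i x] p unfolding M_def by (simp add: ln_ge_iff)
    ultimately show ?thesis by linarith
  qed
  moreover have "(\<lambda>x. - ln (partition_fn f i x)) \<in> borel_measurable (Q i)"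
    using partition_fn_measurable[of f i] tot_boundedD[OF f] i by measurable
  ultimately show ?thesis
    unfolding step_def using tot_bounded_upd[OF f] that[unfolded step_def] by blast
qed

lemma integral_dens_eq_marg:
  assumes "tot_bounded R f" "i \<in> I"
  shows "(\<integral>y. dens f y \<partial>P) = (\<integral>x. marg f i x \<partial>Q i)"
  unfolding marg_def by (rule fubini(2)[OF assms(2) dens_integrable[OF assms(1)]])

lemma integral_dens_eq_1:
  assumes "tot_bounded R f" "i \<in> I" "\<And>x. x \<in> space (Q i) \<Longrightarrow> marg f i x = 1"
  shows "(\<integral>y. dens f y \<partial>P) = 1"
proof -
  interpret prob_space "Q i" by (rule prob_Q[OF assms(2)])
  have "(\<integral>x. marg f i x \<partial>Q i) = (\<integral>x. 1 \<partial>Q i)"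
    using assms(3) by (intro Bochner_Integration.integral_cong) auto
  then show ?thesis using integral_dens_eq_marg[OF assms(1,2)] by (simp add: prob_space)
qed

text \<open>At unit mass the exponential term cancels against the constant 1.\<close>

lemma dual_eq_sum_mean:
  assumes "tot_bounded R f" "i \<in> I" "\<And>x. x \<in> space (Q i) \<Longrightarrow> marg f i x = 1"
  shows "dual f = (\<Sum>j\<in>I. mean f j)"
  using integral_dens_eq_1[OF assms] by (simp add: dual_def mean_def)

text \<open>For the zero tuple the slice mass lies between \<open>exp (- L)\<close> and 1.\<close>

lemma L_nonneg: "0 \<le> L"
proof -
  obtain i where i: "i \<in> I" using I_nonempty by blast
  obtain x where x: "x \<in> space (Q i)" using space_Q_nonempty[OF i] by blast
  have f: "tot_bounded 0 (\<lambda>_ _. 0)" by (auto simp: tot_bounded_def tot_def)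
  have "exp (- L) \<le> partition_fn (\<lambda>_ _. 0) i x" "partition_fn (\<lambda>_ _. 0) i x \<le> exp 0"
    using partition_fn_ge[OF f i x] partition_fn_le[OF f i x, of 0] by (simp_all add: mean_def off_def)
  then have "exp (- L) \<le> exp 0" by linarith
  then show ?thesis by simp
qed

lemma marg_bounds:
  assumes f: "tot_bounded R f" and i: "i \<in> I" and x: "x \<in> space (Q i)"
  shows "marg f i x \<le> exp (R + L)" "exp (- (R + L)) \<le> marg f i x"
proof -
  interpret prob_space "P' i" by (rule prob_P')
  have "marg f i x \<le> (\<integral>y. exp R \<partial>P' i)"
    unfolding marg_def using dens_le[OF f] insert_coord_space[OF i x]
    by (intro integral_mono dens_slice_integrable[OF f i x]) auto
  also have "\<dots> \<le> exp (R + L)" using L_nonneg by (simp add: prob_space)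
  finally show "marg f i x \<le> exp (R + L)" .
  have "exp (- R) * exp (- L) \<le> exp (- R) * (\<integral>y. k (y(i := x)) \<partial>P' i)"
    using slice_lower[OF i x, of "\<lambda>_. 0" 0] by (intro mult_left_mono) auto
  also have "\<dots> = (\<integral>y. exp (- R) * k (y(i := x)) \<partial>P' i)" by simp
  also have "\<dots> \<le> marg f i x"
    unfolding marg_def using dens_ge[OF f] insert_coord_space[OF i x] k_nonneg k_le_1
    by (intro integral_mono dens_slice_integrable[OF f i x] integrable_mult_right
      slice_integrable[where B = 1 and F = k] i x) (auto simp: k_measurable)
  finally show "exp (- (R + L)) \<le> marg f i x" by (simp flip: exp_add)
qed

text \<open>Since \<open>partition_fn\<close> ignores coordinate \<open>i\<close>, both tuples share
  it and their \<open>i\<close>-th marginals differ only by the factor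
  \<open>exp (g i x - f i x)\<close>. Normalizing \<open>g\<close> therefore reads off the marginal
  of \<open>f\<close>, and the bounds on that marginal bound the change.\<close>

lemma update_marg:
  assumes f: "tot_bounded R f" and i: "i \<in> I" and x: "x \<in> space (Q i)"
    and other: "\<And>j. j \<in> I \<Longrightarrow> j \<noteq> i \<Longrightarrow> g j = f j"
    and one: "marg g i x = 1"
  shows "marg f i x = exp (- (g i x - f i x))" "\<bar>g i x - f i x\<bar> \<le> R + L"
proof -
  have "partition_fn g i x = partition_fn f i x"
    using other by (simp add: partition_fn_def off_def)
  then have "exp (g i x) * partition_fn f i x = 1"
    using one by (simp add: marg_eq_partition_fn i)
  then have "partition_fn f i x = exp (- g i x)"
    by (metis exp_minus inverse_unique)
  then show eq: "marg f i x = exp (- (g i x - f i x))"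
    by (simp add: marg_eq_partition_fn i flip: exp_add)
  show "\<bar>g i x - f i x\<bar> \<le> R + L"
    using marg_bounds[OF f i x] unfolding eq by (simp add: abs_le_iff)
qed

text \<open>With \<open>D = g i - f i\<close> the gain is exactly the integral of
  \<open>exp (- D) - 1 + D\<close>; strong convexity of \<open>exp\<close> on the range of
  \<open>D\<close> bounds it below by the square. Only the radius of \<open>f\<close> enters the
  constant.\<close>

lemma update_gain:
  assumes f: "tot_bounded R f" and g: "tot_bounded R' g" and i: "i \<in> I"
    and other: "\<And>j. j \<in> I \<Longrightarrow> j \<noteq> i \<Longrightarrow> g j = f j"
    and one: "\<And>x. x \<in> space (Q i) \<Longrightarrow> marg g i x = 1"
  shows "exp (- (R + L)) / 2 * (\<integral>x. (g i x - f i x)\<^sup>2 \<partial>Q i) \<le> dual g - dual f"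
    and "integrable (Q i) (\<lambda>x. (g i x - f i x)\<^sup>2)"
proof -
  interpret prob_space "Q i" by (rule prob_Q[OF i])
  define D where "D = (\<lambda>x. g i x - f i x)"
  have D: "\<bar>D x\<bar> \<le> R + L" if "x \<in> space (Q i)" for x
    unfolding D_def by (rule update_marg(2)[OF f i that other one[OF that]])
  have m: "marg f i x = exp (- D x)" if "x \<in> space (Q i)" for x
    unfolding D_def by (rule update_marg(1)[OF f i that other one[OF that]])
  note [measurable] = tot_boundedD(1)[OF f i] tot_boundedD(1)[OF g i]
  have Dm[measurable]: "D \<in> borel_measurable (Q i)" unfolding D_def by measurable
  have Dint: "integrable (Q i) D" by (rule integrable_bounded_Q[OF i Dm D])
  have "(D x)\<^sup>2 \<le> (R + L)\<^sup>2" if "x \<in> space (Q i)" for x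
    using D[OF that] by (simp add: abs_le_square_iff[symmetric])
  then have D2int: "integrable (Q i) (\<lambda>x. (D x)\<^sup>2)"
    by (intro integrable_bounded_Q[where B = "(R + L)\<^sup>2"] i) auto
  then show "integrable (Q i) (\<lambda>x. (g i x - f i x)\<^sup>2)" by (simp add: D_def)
  have Eint: "integrable (Q i) (\<lambda>x. exp (- D x))"
    using D by (intro integrable_bounded_Q[where B = "exp (R + L)"] i) (auto simp: abs_le_iff)
  have "exp (- (R + L)) / 2 * (\<integral>x. (D x)\<^sup>2 \<partial>Q i) = (\<integral>x. exp (- (R + L)) / 2 * (D x)\<^sup>2 \<partial>Q i)"
    by simp
  also have "\<dots> \<le> (\<integral>x. exp (- D x) - 1 + D x \<partial>Q i)"
  proof (intro integral_mono)
    show "exp (- (R + L)) / 2 * (D x)\<^sup>2 \<le> exp (- D x) - 1 + D x" if "x \<in> space (Q i)" for x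
      using exp_ge_quadratic[of "- D x" "R + L"] D[OF that] by simp
  qed (use Dint D2int Eint in auto)
  also have "\<dots> = (\<integral>x. exp (- D x) \<partial>Q i) - 1 + (\<integral>x. D x \<partial>Q i)"
    using Dint Eint by (simp add: prob_space)
  also have "(\<integral>x. exp (- D x) \<partial>Q i) = (\<integral>y. dens f y \<partial>P)"
    unfolding integral_dens_eq_marg[OF f i] using m by (intro Bochner_Integration.integral_cong) auto
  also have "(\<integral>x. D x \<partial>Q i) = mean g i - mean f i"
    unfolding D_def mean_def using tot_bounded_integrable[OF f i] tot_bounded_integrable[OF g i] by simp
  also have "(\<integral>y. dens f y \<partial>P) - 1 + (mean g i - mean f i) = dual g - dual f"
  proof -
    have "(\<Sum>j\<in>I. mean g j) - (\<Sum>j\<in>I. mean f j) = mean g i - mean f i"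
      using other by (simp add: sum.remove[OF finite_I i] mean_def)
    then show ?thesis
      using integral_dens_eq_1[OF g i one] by (simp add: dual_def mean_def)
  qed
  finally show "exp (- (R + L)) / 2 * (\<integral>x. (g i x - f i x)\<^sup>2 \<partial>Q i) \<le> dual g - dual f"
    by (simp add: D_def)
qed


text \<open>Coordinate \<open>i\<close> is compared pointwise, the others only in mean, because the
  marginal integrates them out. This asymmetry later turns smallness in mean into uniform
  smallness.\<close>

lemma marg_lipschitz:
  assumes f: "tot_bounded R f" and g: "tot_bounded R g" and i: "i \<in> I" and x: "x \<in> space (Q i)"
  shows "\<bar>marg f i x - marg g i x\<bar>
    \<le> exp R * (\<bar>f i x - g i x\<bar> + (\<Sum>j\<in>I - {i}. \<integral>x. \<bar>f j x - g j x\<bar> \<partial>Q j))"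
proof -
  interpret prob_space "P' i" by (rule prob_P')
  let ?d = "\<lambda>y. (\<Sum>j\<in>I - {i}. \<bar>f j (y j) - g j (y j)\<bar>)"
  have int: "integrable (P' i) (\<lambda>y. \<bar>f j (y j) - g j (y j)\<bar>)" if "j \<in> I - {i}" for j
    using that tot_bounded_integrable[OF f] tot_bounded_integrable[OF g]
    by (intro integrable_component[of "I - {i}" j "\<lambda>x. \<bar>f j x - g j x\<bar>"]) auto
  have dint: "integrable (P' i) (\<lambda>y. exp R * (\<bar>f i x - g i x\<bar> + ?d y))"
    using int by (intro integrable_mult_right Bochner_Integration.integrable_add
      Bochner_Integration.integrable_sum) auto
  have pointwise: "\<bar>dens f (y(i := x)) - dens g (y(i := x))\<bar> \<le> exp R * (\<bar>f i x - g i x\<bar> + ?d y)"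
    if "y \<in> space (P' i)" for y
  proof -
    let ?z = "y(i := x)"
    have z: "?z \<in> space P" by (rule insert_coord_space[OF i x that])
    have "\<bar>dens f ?z - dens g ?z\<bar> = \<bar>exp (tot f ?z) - exp (tot g ?z)\<bar> * k ?z"
      using k_nonneg[OF z] by (simp add: dens_def abs_mult flip: left_diff_distrib)
    also have "\<dots> \<le> \<bar>exp (tot f ?z) - exp (tot g ?z)\<bar> * 1"
      using k_le_1[OF z] by (intro mult_left_mono) auto
    also have "\<dots> \<le> exp R * \<bar>tot f ?z - tot g ?z\<bar>"
      using tot_boundedD(2)[OF f z] tot_boundedD(2)[OF g z] abs_exp_diff_le[of "tot f ?z" R "tot g ?z"]
      by (simp add: abs_le_iff)
    also have "\<bar>tot f ?z - tot g ?z\<bar> \<le> \<bar>f i x - g i x\<bar> + \<bar>off f i y - off g i y\<bar>"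
      unfolding tot_insert[OF i] by linarith
    also have "\<bar>off f i y - off g i y\<bar> \<le> ?d y"
      unfolding off_def sum_subtractf[symmetric] by (rule sum_abs)
    finally show ?thesis by simp
  qed
  have "\<bar>marg f i x - marg g i x\<bar> = \<bar>\<integral>y. dens f (y(i := x)) - dens g (y(i := x)) \<partial>P' i\<bar>"
    unfolding marg_def
    by (subst Bochner_Integration.integral_diff)
       (auto intro: dens_slice_integrable[OF f i x] dens_slice_integrable[OF g i x])
  also have "\<dots> \<le> (\<integral>y. \<bar>dens f (y(i := x)) - dens g (y(i := x))\<bar> \<partial>P' i)"
    by (rule integral_abs_bound)
  also have "\<dots> \<le> (\<integral>y. exp R * (\<bar>f i x - g i x\<bar> + ?d y) \<partial>P' i)"
    using pointwise by (intro integral_mono dint integrable_abs Bochner_Integration.integrable_diff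
      dens_slice_integrable[OF f i x] dens_slice_integrable[OF g i x]) auto
  also have "\<dots> = exp R * (\<bar>f i x - g i x\<bar> + (\<Sum>j\<in>I - {i}. \<integral>y. \<bar>f j (y j) - g j (y j)\<bar> \<partial>P' i))"
  proof -
    have "integrable (P' i) ?d" using int by (intro Bochner_Integration.integrable_sum) auto
    moreover have "(\<integral>y. ?d y \<partial>P' i) = (\<Sum>j\<in>I - {i}. \<integral>y. \<bar>f j (y j) - g j (y j)\<bar> \<partial>P' i)"
      using int by (intro Bochner_Integration.integral_sum) auto
    ultimately show ?thesis by (simp add: prob_space)
  qed
  also have "(\<Sum>j\<in>I - {i}. \<integral>y. \<bar>f j (y j) - g j (y j)\<bar> \<partial>P' i) = (\<Sum>j\<in>I - {i}. \<integral>x. \<bar>f j x - g j x\<bar> \<partial>Q j)"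
  proof (intro sum.cong refl)
    fix j assume j: "j \<in> I - {i}"
    have [measurable]: "f j \<in> borel_measurable (Q j)" "g j \<in> borel_measurable (Q j)"
      using j f g by (auto dest: tot_boundedD)
    show "(\<integral>y. \<bar>f j (y j) - g j (y j)\<bar> \<partial>P' i) = (\<integral>x. \<bar>f j x - g j x\<bar> \<partial>Q j)"
      by (rule integral_component[of "I - {i}" j "\<lambda>x. \<bar>f j x - g j x\<bar>"]) (use j in auto)
  qed
  finally show ?thesis .
qed

text \<open>Two slices of the kernel overlap in mass at least \<open>exp (- 2 * L)\<close>. On the overlap,
  \<open>w i x - w i x'\<close> is the difference of two values of \<open>tot w\<close>.\<close>

lemma coordinate_variance:
  assumes w: "\<And>i. i \<in> I \<Longrightarrow> w i \<in> borel_measurable (Q i)" and i: "i \<in> I"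
  obtains a where "(\<integral>\<^sup>+ x. ennreal ((w i x - a)\<^sup>2) \<partial>Q i)
    \<le> ennreal (4 * exp (2 * L)) * (\<integral>\<^sup>+ y. ennreal ((tot w y)\<^sup>2 * k y) \<partial>P)"
proof -
  interpret Qi: prob_space "Q i" by (rule prob_Q[OF i])
  define F where "F = (\<lambda>y. ennreal ((tot w y)\<^sup>2 * k y))"
  have Fm: "F \<in> borel_measurable P"
    unfolding F_def
    by (intro measurable_compose[OF _ measurable_ennreal] borel_measurable_times
      borel_measurable_power tot_measurable w k_measurable)
  define h where "h = (\<lambda>x. \<integral>\<^sup>+ y. F (y(i := x)) \<partial>P' i)"
  have hm[measurable]: "h \<in> borel_measurable (Q i)"
    unfolding h_def by (rule nn_fubini_measurable[OF i Fm])
  define H where "H = (\<integral>\<^sup>+ y. F y \<partial>P)"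
  have H: "H = (\<integral>\<^sup>+ x. h x \<partial>Q i)"
    unfolding H_def h_def by (rule nn_fubini[OF i Fm])
  note wm[measurable] = w[OF i]
  show ?thesis
  \<comment> \<open>\<open>w\<close> may be unbounded, so \<open>H\<close> may be infinite; then any
    constant serves.\<close>
  proof (cases "H = \<infinity>")
    case True
    have "ennreal (4 * exp (2 * L)) * H = \<infinity>"
      unfolding True by (simp add: ennreal_mult_top)
    then show ?thesis
      by (intro that[of 0]) (simp add: H_def F_def)
  next
    case False
    \<comment> \<open>Some slice integral does not exceed the average \<open>H\<close>. This
      \<open>x'\<close> is the base point, and \<open>w i x'\<close> becomes the constant.\<close>
    have "\<exists>x'\<in>space (Q i). h x' \<le> H"
    proof (rule ccontr)
      assume neg: "\<not> ?thesis"
      have "(\<integral>\<^sup>+ x. H \<partial>Q i) < (\<integral>\<^sup>+ x. h x \<partial>Q i)"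
      proof (rule nn_integral_less)
        show "(\<integral>\<^sup>+ x. H \<partial>Q i) \<noteq> \<infinity>" using False by (simp add: Qi.emeasure_space_1)
        show "AE x in Q i. H \<le> h x" using neg by (intro AE_I2) auto
        show "\<not> (AE x in Q i. h x \<le> H)"
        proof
          assume "AE x in Q i. h x \<le> H"
          moreover have "AE x in Q i. \<not> h x \<le> H" using neg by (intro AE_I2) auto
          ultimately have "AE x in Q i. False" by eventually_elim simp
          then show False by simp
        qed
      qed auto
      then show False by (simp add: H[symmetric] Qi.emeasure_space_1)
    qed
    then obtain x' where x': "x' \<in> space (Q i)" "h x' \<le> H" by blast
    define a where "a = w i x'"
    have pt: "ennreal (exp (- 2 * L)) * ennreal ((w i x - a)\<^sup>2) \<le> 2 * h x + 2 * h x'"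
      if x: "x \<in> space (Q i)" for x
    proof -
      let ?kk = "\<lambda>y. k (y(i := x)) * k (y(i := x'))"
      have km[measurable]: "(\<lambda>y. k (y(i := z))) \<in> borel_measurable (P' i)" if "z \<in> space (Q i)" for z
        by (rule measurable_compose[OF insert_coord_measurable'[OF i that] k_measurable])
      have FM: "(\<lambda>y. F (y(i := z))) \<in> borel_measurable (P' i)" if "z \<in> space (Q i)" for z
        by (rule measurable_compose[OF insert_coord_measurable'[OF i that] Fm])
      have kk: "0 \<le> ?kk y" "?kk y \<le> 1" if "y \<in> space (P' i)" for y
        using k_nonneg k_le_1 insert_coord_space[OF i _ that] x x'(1) by (auto intro: mult_le_one)
      have kkint: "integrable (P' i) ?kk"
        using kk x x'(1) by (intro integrable_bounded_P'[where B = 1] borel_measurable_times km) auto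
      have "ennreal (exp (- 2 * L)) \<le> ennreal (\<integral>y. ?kk y \<partial>P' i)"
        by (intro ennreal_leI overlap i x x')
      also have "\<dots> = (\<integral>\<^sup>+ y. ennreal (?kk y) \<partial>P' i)"
        using kk by (intro nn_integral_eq_integral[symmetric] kkint AE_I2) auto
      finally have "ennreal (exp (- 2 * L)) * ennreal ((w i x - a)\<^sup>2)
          \<le> (\<integral>\<^sup>+ y. ennreal (?kk y) \<partial>P' i) * ennreal ((w i x - a)\<^sup>2)"
        by (intro mult_right_mono) auto
      also have "\<dots> = (\<integral>\<^sup>+ y. ennreal (?kk y) * ennreal ((w i x - a)\<^sup>2) \<partial>P' i)"
        using x x'(1) by (intro nn_integral_multc[symmetric]) measurable
      also have "\<dots> \<le> (\<integral>\<^sup>+ y. 2 * F (y(i := x)) + 2 * F (y(i := x')) \<partial>P' i)"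
      proof (intro nn_integral_mono)
        fix y assume y: "y \<in> space (P' i)"
        let ?s = "tot w (y(i := x))" and ?t = "tot w (y(i := x'))"
        let ?k = "k (y(i := x))" and ?k' = "k (y(i := x'))"
        have k: "0 \<le> ?k" "?k \<le> 1" "0 \<le> ?k'" "?k' \<le> 1"
          using k_nonneg k_le_1 insert_coord_space[OF i _ y] x x'(1) by auto
        have "w i x - a = ?s - ?t" by (simp add: a_def tot_insert i)
        moreover have "(?s - ?t)\<^sup>2 \<le> 2 * ?s\<^sup>2 + 2 * ?t\<^sup>2"
          using zero_le_power2[of "?s + ?t"] by (simp add: power2_eq_square algebra_simps)
        ultimately have "?k * ?k' * (w i x - a)\<^sup>2 \<le> ?k * ?k' * (2 * ?s\<^sup>2 + 2 * ?t\<^sup>2)"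
          using k by (intro mult_left_mono) auto
        also have "\<dots> = ?k' * (2 * (?s\<^sup>2 * ?k)) + ?k * (2 * (?t\<^sup>2 * ?k'))"
          by (simp add: algebra_simps)
        also have "\<dots> \<le> 1 * (2 * (?s\<^sup>2 * ?k)) + 1 * (2 * (?t\<^sup>2 * ?k'))"
          using k by (intro add_mono mult_right_mono) auto
        finally have "ennreal (?k * ?k' * (w i x - a)\<^sup>2) \<le> ennreal (2 * (?s\<^sup>2 * ?k) + 2 * (?t\<^sup>2 * ?k'))"
          by (intro ennreal_leI) simp
        then show "ennreal (?k * ?k') * ennreal ((w i x - a)\<^sup>2) \<le> 2 * F (y(i := x)) + 2 * F (y(i := x'))"
          using k by (simp add: F_def ennreal_mult ennreal_plus)
      qed
      also have "\<dots> = 2 * h x + 2 * h x'"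
        unfolding h_def using FM[OF x] FM[OF x'(1)]
        by (simp add: nn_integral_add nn_integral_cmult)
      finally show ?thesis .
    qed
    have "ennreal (exp (- 2 * L)) * (\<integral>\<^sup>+ x. ennreal ((w i x - a)\<^sup>2) \<partial>Q i)
        = (\<integral>\<^sup>+ x. ennreal (exp (- 2 * L)) * ennreal ((w i x - a)\<^sup>2) \<partial>Q i)"
      by (intro nn_integral_cmult[symmetric]) measurable
    also have "\<dots> \<le> (\<integral>\<^sup>+ x. 2 * h x + 2 * h x' \<partial>Q i)"
      using pt by (intro nn_integral_mono) auto
    also have "\<dots> = 2 * H + 2 * h x'"
      by (simp add: nn_integral_add nn_integral_cmult H[symmetric] Qi.emeasure_space_1)
    also have "\<dots> \<le> 2 * H + 2 * H"
      using x'(2) by (intro add_left_mono mult_left_mono) auto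
    also have "\<dots> = 4 * H" by (metis distrib_right numeral_Bit0)
    finally have "ennreal (exp (2 * L)) * (ennreal (exp (- 2 * L)) * (\<integral>\<^sup>+ x. ennreal ((w i x - a)\<^sup>2) \<partial>Q i))
        \<le> ennreal (exp (2 * L)) * (4 * H)"
      by (intro mult_left_mono) auto
    also have "ennreal (exp (2 * L)) * (ennreal (exp (- 2 * L)) * (\<integral>\<^sup>+ x. ennreal ((w i x - a)\<^sup>2) \<partial>Q i))
        = (\<integral>\<^sup>+ x. ennreal ((w i x - a)\<^sup>2) \<partial>Q i)"
      by (simp add: mult.assoc[symmetric] ennreal_mult[symmetric] flip: exp_add)
    also have "ennreal (exp (2 * L)) * (4 * H) = ennreal (4 * exp (2 * L)) * H"
      by (simp add: ennreal_mult mult_ac)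
    finally show ?thesis
      by (intro that[of a]) (simp add: H_def F_def)
  qed
qed

section \<open>Expansion of the dual functional, its gap, and optimality\<close>

lemma dens_weighted:
  fixes h :: "'a \<Rightarrow> real"
  assumes f: "tot_bounded R f" and i: "i \<in> I" and h: "integrable (Q i) h"
  shows "integrable P (\<lambda>y. dens f y * h (y i))"
    and "(\<integral>y. dens f y * h (y i) \<partial>P) = (\<integral>x. h x * marg f i x \<partial>Q i)"
proof -
  have hP: "integrable P (\<lambda>y. h (y i))" by (rule integrable_component[OF order_refl i h])
  have dm: "dens f \<in> borel_measurable P"
    using f by (intro dens_measurable) (auto dest: tot_boundedD)
  show int: "integrable P (\<lambda>y. dens f y * h (y i))"
  proof (rule Bochner_Integration.integrable_bound)
    show "integrable P (\<lambda>y. exp R * h (y i))" using hP by simp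
    show "AE y in P. norm (dens f y * h (y i)) \<le> norm (exp R * h (y i))"
      using dens_le[OF f] dens_nonneg by (intro AE_I2) (auto simp: abs_mult intro!: mult_right_mono)
    show "(\<lambda>y. dens f y * h (y i)) \<in> borel_measurable P"
      using dm hP by (intro borel_measurable_times) auto
  qed
  have "(\<integral>y. dens f y * h (y i) \<partial>P) = (\<integral>x. \<integral>y. dens f (y(i := x)) * h ((y(i := x)) i) \<partial>P' i \<partial>Q i)"
    by (rule fubini(2)[OF i int])
  also have "\<dots> = (\<integral>x. h x * marg f i x \<partial>Q i)"
    by (simp add: marg_def mult.commute)
  finally show "(\<integral>y. dens f y * h (y i) \<partial>P) = (\<integral>x. h x * marg f i x \<partial>Q i)" .
qed

lemma dual_diff:
  assumes f: "tot_bounded R f" and v: "\<And>i. i \<in> I \<Longrightarrow> integrable (Q i) (v i)"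
    and dv: "integrable P (dens v)"
  defines "W \<equiv> \<lambda>y. tot v y - tot f y"
  shows "integrable P (\<lambda>y. dens f y * (exp (W y) - 1 - W y))"
    and "dual v - dual f = (\<Sum>i\<in>I. \<integral>x. (v i x - f i x) * (1 - marg f i x) \<partial>Q i)
      - (\<integral>y. dens f y * (exp (W y) - 1 - W y) \<partial>P)"
proof -
  have w: "integrable (Q i) (\<lambda>x. v i x - f i x)" if "i \<in> I" for i
    using v that tot_bounded_integrable[OF f] by auto
  have eq: "dens f y * (exp (W y) - 1 - W y)
      = dens v y - dens f y - (\<Sum>i\<in>I. dens f y * (v i (y i) - f i (y i)))" for y
  proof -
    have "dens f y * exp (W y) = dens v y"
      by (simp add: dens_def W_def exp_diff)
    moreover have "dens f y * W y = (\<Sum>i\<in>I. dens f y * (v i (y i) - f i (y i)))"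
      by (simp add: W_def tot_def sum_distrib_left flip: sum_subtractf)
    ultimately show ?thesis by (simp add: right_diff_distrib)
  qed
  have df: "integrable P (dens f)" by (rule dens_integrable[OF f])
  have s: "integrable P (\<lambda>y. \<Sum>i\<in>I. dens f y * (v i (y i) - f i (y i)))"
    by (intro Bochner_Integration.integrable_sum dens_weighted(1)[OF f _ w])
  show "integrable P (\<lambda>y. dens f y * (exp (W y) - 1 - W y))"
    unfolding eq using df dv s by auto
  have "(\<integral>y. dens f y * (exp (W y) - 1 - W y) \<partial>P)
      = (\<integral>y. dens v y \<partial>P) - (\<integral>y. dens f y \<partial>P)
        - (\<integral>y. (\<Sum>i\<in>I. dens f y * (v i (y i) - f i (y i))) \<partial>P)"
    unfolding eq using df dv s by simp
  also have "(\<integral>y. (\<Sum>i\<in>I. dens f y * (v i (y i) - f i (y i))) \<partial>P)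
      = (\<Sum>i\<in>I. \<integral>x. (v i x - f i x) * marg f i x \<partial>Q i)"
    using dens_weighted[OF f _ w] by (simp add: Bochner_Integration.integral_sum)
  finally have *: "(\<integral>y. dens f y * (exp (W y) - 1 - W y) \<partial>P)
    = (\<integral>y. dens v y \<partial>P) - (\<integral>y. dens f y \<partial>P) - (\<Sum>i\<in>I. \<integral>x. (v i x - f i x) * marg f i x \<partial>Q i)" .
  have "(\<integral>x. (v i x - f i x) * (1 - marg f i x) \<partial>Q i)
      = (\<integral>x. v i x \<partial>Q i) - (\<integral>x. f i x \<partial>Q i) - (\<integral>x. (v i x - f i x) * marg f i x \<partial>Q i)"
    if i: "i \<in> I" for i
  proof -
    have "integrable (Q i) (\<lambda>x. \<integral>y. dens f (y(i := x)) * (v i ((y(i := x)) i) - f i ((y(i := x)) i)) \<partial>P' i)"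
      by (rule fubini(1)[OF i dens_weighted(1)[OF f i w[OF i]]])
    then have "integrable (Q i) (\<lambda>x. (v i x - f i x) * marg f i x)"
      by (simp add: marg_def mult.commute)
    then show ?thesis
      using w[OF i] v[OF i] tot_bounded_integrable[OF f i] by (simp add: right_diff_distrib)
  qed
  then show "dual v - dual f = (\<Sum>i\<in>I. \<integral>x. (v i x - f i x) * (1 - marg f i x) \<partial>Q i)
      - (\<integral>y. dens f y * (exp (W y) - 1 - W y) \<partial>P)"
    unfolding * dual_def by (simp add: sum_subtractf)
qed


lemma tot_diff: "tot (\<lambda>i x. v i x - f i x) y = tot v y - tot f y"
  by (simp add: tot_def sum_subtractf)

lemma tot_bounded_diff:
  assumes "tot_bounded R v" "tot_bounded R' f"
  shows "tot_bounded (R + R') (\<lambda>i x. v i x - f i x)"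
  unfolding tot_bounded_def tot_diff
proof (intro conjI ballI)
  show "(\<lambda>x. v i x - f i x) \<in> borel_measurable (Q i)" if "i \<in> I" for i
    using tot_boundedD(1)[OF assms(1) that] tot_boundedD(1)[OF assms(2) that] by measurable
  show "\<bar>tot v y - tot f y\<bar> \<le> R + R'" if "y \<in> space P" for y
    using tot_boundedD(2)[OF assms(1) that] tot_boundedD(2)[OF assms(2) that] by linarith
qed

lemma tot_bounded_square_integrable:
  assumes "tot_bounded R w"
  shows "integrable P (\<lambda>y. (tot w y)\<^sup>2 * k y)"
proof (rule integrable_bounded_P[where B = "R\<^sup>2"])
  show "(\<lambda>y. (tot w y)\<^sup>2 * k y) \<in> borel_measurable P"
    using assms by (intro borel_measurable_times borel_measurable_power tot_measurable k_measurable)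
      (auto dest: tot_boundedD)
  show "\<bar>(tot w y)\<^sup>2 * k y\<bar> \<le> R\<^sup>2" if y: "y \<in> space P" for y
  proof -
    have "(tot w y)\<^sup>2 * k y \<le> R\<^sup>2 * 1"
      using tot_boundedD(2)[OF assms y] k_nonneg[OF y] k_le_1[OF y]
      by (intro mult_mono) (auto simp flip: abs_le_square_iff)
    then show ?thesis using k_nonneg[OF y] by (simp add: abs_mult)
  qed
qed

lemma coordinate_variance_bounded:
  assumes w: "tot_bounded R w" and i: "i \<in> I"
  obtains a where "integrable (Q i) (\<lambda>x. (w i x - a)\<^sup>2)"
    "(\<integral>x. (w i x - a)\<^sup>2 \<partial>Q i) \<le> 4 * exp (2 * L) * (\<integral>y. (tot w y)\<^sup>2 * k y \<partial>P)"
proof -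
  obtain a where a: "(\<integral>\<^sup>+ x. ennreal ((w i x - a)\<^sup>2) \<partial>Q i)
    \<le> ennreal (4 * exp (2 * L)) * (\<integral>\<^sup>+ y. ennreal ((tot w y)\<^sup>2 * k y) \<partial>P)"
    using coordinate_variance[of w i] tot_boundedD(1)[OF w] i by blast
  obtain B where B: "\<And>x. x \<in> space (Q i) \<Longrightarrow> \<bar>w i x\<bar> \<le> B"
    using tot_bounded_component[OF w i] by blast
  have wm[measurable]: "w i \<in> borel_measurable (Q i)" by (rule tot_boundedD(1)[OF w i])
  have "(w i x - a)\<^sup>2 \<le> (B + \<bar>a\<bar>)\<^sup>2" if "x \<in> space (Q i)" for x
    using B[OF that] by (simp flip: abs_le_square_iff)
  then have int: "integrable (Q i) (\<lambda>x. (w i x - a)\<^sup>2)"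
    by (intro integrable_bounded_Q[where B = "(B + \<bar>a\<bar>)\<^sup>2"] i) auto
  have nonneg: "0 \<le> (\<integral>y. (tot w y)\<^sup>2 * k y \<partial>P)"
    using k_nonneg by (intro integral_nonneg_AE AE_I2) auto
  have "(\<integral>\<^sup>+ y. ennreal ((tot w y)\<^sup>2 * k y) \<partial>P) = ennreal (\<integral>y. (tot w y)\<^sup>2 * k y \<partial>P)"
    using k_nonneg by (intro nn_integral_eq_integral tot_bounded_square_integrable[OF w] AE_I2) auto
  moreover have "(\<integral>\<^sup>+ x. ennreal ((w i x - a)\<^sup>2) \<partial>Q i) = ennreal (\<integral>x. (w i x - a)\<^sup>2 \<partial>Q i)"
    by (intro nn_integral_eq_integral int) auto
  ultimately have "(\<integral>x. (w i x - a)\<^sup>2 \<partial>Q i) \<le> 4 * exp (2 * L) * (\<integral>y. (tot w y)\<^sup>2 * k y \<partial>P)"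
    using a nonneg by (simp add: ennreal_mult[symmetric])
  then show ?thesis by (rule that[OF int])
qed

text \<open>A Polyak-Lojasiewicz inequality: completing the square in each coordinate, with the constants
  \<open>a i\<close> subtracted at no cost because \<open>1 - marg f i\<close> has mean zero.\<close>

lemma dual_gap:
  assumes f: "tot_bounded R f" and v: "tot_bounded R v" and mass: "(\<integral>y. dens f y \<partial>P) = 1"
  shows "dual v - dual f \<le> 2 * real (card I) * exp (3 * R + 2 * L) * (\<Sum>i\<in>I. \<integral>x. (1 - marg f i x)\<^sup>2 \<partial>Q i)"
proof -
  define n where "n = real (card I)"
  have n: "n > 0" using finite_I I_nonempty by (simp add: n_def card_gt_0_iff)
  define w where "w = (\<lambda>i x. v i x - f i x)"
  have w: "tot_bounded (R + R) w" unfolding w_def by (rule tot_bounded_diff[OF v f])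
  define E where "E = (\<integral>y. (tot w y)\<^sup>2 * k y \<partial>P)"
  \<comment> \<open>Chosen so that \<open>lam\<close> times the bound on the sum of the
    \<open>S i\<close> is exactly \<open>exp (- (3 * R)) / 2 * E\<close>. In this exponent one
    \<open>R\<close> comes from \<open>dens f \<ge> exp (- R) * k\<close>, two come from the
    convexity of \<open>exp\<close> on the range of \<open>tot w\<close>, which is bounded by
    \<open>2 * R\<close>.\<close>
  define lam where "lam = exp (- (3 * R + 2 * L)) / (8 * n)"
  have lam: "lam > 0" using n by (simp add: lam_def)
  have "\<forall>i\<in>I. \<exists>a. integrable (Q i) (\<lambda>x. (w i x - a)\<^sup>2) \<and> (\<integral>x. (w i x - a)\<^sup>2 \<partial>Q i) \<le> 4 * exp (2 * L) * E"
  proof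
    fix i assume "i \<in> I"
    from coordinate_variance_bounded[OF w this] show "\<exists>a. integrable (Q i) (\<lambda>x. (w i x - a)\<^sup>2) \<and>
        (\<integral>x. (w i x - a)\<^sup>2 \<partial>Q i) \<le> 4 * exp (2 * L) * E"
      unfolding E_def by blast
  qed
  from bchoice[OF this] obtain a where a: "\<forall>i\<in>I. integrable (Q i) (\<lambda>x. (w i x - a i)\<^sup>2) \<and>
      (\<integral>x. (w i x - a i)\<^sup>2 \<partial>Q i) \<le> 4 * exp (2 * L) * E" ..
  then have a: "integrable (Q i) (\<lambda>x. (w i x - a i)\<^sup>2)"
    "(\<integral>x. (w i x - a i)\<^sup>2 \<partial>Q i) \<le> 4 * exp (2 * L) * E" if "i \<in> I" for i
    using that by auto
  define S where "S = (\<lambda>i. \<integral>x. (w i x - a i)\<^sup>2 \<partial>Q i)"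
  have "(\<Sum>i\<in>I. S i) \<le> (\<Sum>i\<in>I. 4 * exp (2 * L) * E)"
    unfolding S_def by (intro sum_mono a(2))
  then have "lam * (\<Sum>i\<in>I. S i) \<le> lam * (n * (4 * exp (2 * L) * E))"
    using lam by (simp add: n_def)
  also have "\<dots> = exp (- (3 * R)) / 2 * E"
  proof -
    have "lam * n * 8 = exp (- (3 * R + 2 * L))" using n by (simp add: lam_def)
    moreover have "exp (- (3 * R + 2 * L)) * exp (2 * L) = exp (- (3 * R))" by (simp flip: exp_add)
    moreover have "lam * (n * (4 * exp (2 * L) * E)) = (lam * n * 8) * exp (2 * L) / 2 * E" by simp
    ultimately show ?thesis by presburger
  qed
  also have "\<dots> = (\<integral>y. exp (- (3 * R)) / 2 * ((tot w y)\<^sup>2 * k y) \<partial>P)"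
    by (simp add: E_def)
  also have "\<dots> \<le> (\<integral>y. dens f y * (exp (tot v y - tot f y) - 1 - (tot v y - tot f y)) \<partial>P)"
  proof (intro integral_mono dual_diff(1)[OF f] tot_bounded_integrable[OF v] dens_integrable[OF v]
      integrable_mult_right tot_bounded_square_integrable[OF w])
    fix y assume y: "y \<in> space P"
    have "exp (- (3 * R)) / 2 * ((tot w y)\<^sup>2 * k y) = (exp (- R) * k y) * (exp (- (R + R)) * (tot w y)\<^sup>2 / 2)"
    proof -
      have "exp (- (3 * R)) = exp (- R) * exp (- (R + R))" by (simp flip: exp_add)
      then show ?thesis by simp
    qed
    also have "\<dots> \<le> dens f y * (exp (tot w y) - 1 - tot w y)"
      using exp_ge_quadratic[OF tot_boundedD(2)[OF w y]] dens_ge[OF f y] dens_nonneg[OF y]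
      by (intro mult_mono) auto
    finally show "exp (- (3 * R)) / 2 * ((tot w y)\<^sup>2 * k y)
        \<le> dens f y * (exp (tot v y - tot f y) - 1 - (tot v y - tot f y))"
      by (simp add: w_def tot_diff)
  qed
  finally have quad: "lam * (\<Sum>i\<in>I. S i)
      \<le> (\<integral>y. dens f y * (exp (tot v y - tot f y) - 1 - (tot v y - tot f y)) \<partial>P)" .
  have lin: "(\<integral>x. w i x * (1 - marg f i x) \<partial>Q i) \<le> lam * S i + (\<integral>x. (1 - marg f i x)\<^sup>2 \<partial>Q i) / (4 * lam)"
    if i: "i \<in> I" for i
  proof -
    interpret prob_space "Q i" by (rule prob_Q[OF i])
    define m where "m = marg f i"
    have mm[measurable]: "m \<in> borel_measurable (Q i)"
      unfolding m_def using f i by (intro marg_measurable) (auto dest: tot_boundedD)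
    have [measurable]: "w i \<in> borel_measurable (Q i)" by (rule tot_boundedD(1)[OF w i])
    have m: "0 < m x" "m x \<le> exp (R + L)" if "x \<in> space (Q i)" for x
      using marg_bounds[OF f i that] exp_gt_zero[of "- (R + L)"] unfolding m_def by linarith+
    have mint: "integrable (Q i) m"
      using m by (intro integrable_bounded_Q[where B = "exp (R + L)"] i mm) (auto simp: less_imp_le)
    have "\<bar>1 - m x\<bar> \<le> 1 + exp (R + L)" if "x \<in> space (Q i)" for x
      using m[OF that] by linarith
    then have m1: "\<bar>1 - m x\<bar> \<le> \<bar>1 + exp (R + L)\<bar>" if "x \<in> space (Q i)" for x
      using that by force
    have m2int: "integrable (Q i) (\<lambda>x. (1 - m x)\<^sup>2)"
      using m1 by (intro integrable_bounded_Q[where B = "(1 + exp (R + L))\<^sup>2"] i)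
        (auto simp flip: abs_le_square_iff)
    obtain B where B: "\<And>x. x \<in> space (Q i) \<Longrightarrow> \<bar>w i x\<bar> \<le> B"
      using tot_bounded_component[OF w i] by blast
    have wmint: "integrable (Q i) (\<lambda>x. w i x * (1 - m x))"
      using m1 B by (intro integrable_bounded_Q[where B = "B * \<bar>1 + exp (R + L)\<bar>"] i)
        (auto simp: abs_mult intro!: mult_mono order_trans[OF abs_ge_zero B])
    \<comment> \<open>The defect has mean zero because the total mass is one.\<close>
    have "(\<integral>x. (1 - m x) \<partial>Q i) = 0"
      using integral_dens_eq_marg[OF f i] mass mint by (simp add: m_def prob_space)
    then have "(\<integral>x. w i x * (1 - m x) \<partial>Q i) = (\<integral>x. w i x * (1 - m x) \<partial>Q i) - (\<integral>x. a i * (1 - m x) \<partial>Q i)"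
      by simp
    also have "\<dots> = (\<integral>x. w i x * (1 - m x) - a i * (1 - m x) \<partial>Q i)"
      using wmint mint by (intro Bochner_Integration.integral_diff[symmetric]) auto
    also have "\<dots> \<le> (\<integral>x. lam * (w i x - a i)\<^sup>2 + (1 - m x)\<^sup>2 / (4 * lam) \<partial>Q i)"
    proof (intro integral_mono)
      show "w i x * (1 - m x) - a i * (1 - m x) \<le> lam * (w i x - a i)\<^sup>2 + (1 - m x)\<^sup>2 / (4 * lam)" for x
      proof -
        have "0 \<le> (2 * lam * (w i x - a i) - (1 - m x))\<^sup>2 / (4 * lam)" using lam by simp
        also have "\<dots> = lam * (w i x - a i)\<^sup>2 + (1 - m x)\<^sup>2 / (4 * lam) - (w i x - a i) * (1 - m x)"
          using lam by (simp add: field_simps power2_eq_square)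
        finally show ?thesis by (simp add: left_diff_distrib)
      qed
    qed (use wmint mint a(1)[OF i] m2int in auto)
    also have "\<dots> = lam * S i + (\<integral>x. (1 - m x)\<^sup>2 \<partial>Q i) / (4 * lam)"
      unfolding S_def using a(1)[OF i] m2int by simp
    finally show ?thesis by (simp add: m_def)
  qed
  have "dual v - dual f = (\<Sum>i\<in>I. \<integral>x. w i x * (1 - marg f i x) \<partial>Q i)
      - (\<integral>y. dens f y * (exp (tot v y - tot f y) - 1 - (tot v y - tot f y)) \<partial>P)"
    unfolding w_def by (rule dual_diff(2)[OF f tot_bounded_integrable[OF v] dens_integrable[OF v]])
  \<comment> \<open>The quadratic remainder absorbs all the terms \<open>lam * S i\<close>, so only
    the defects survive.\<close>
  also have "\<dots> \<le> (\<Sum>i\<in>I. lam * S i + (\<integral>x. (1 - marg f i x)\<^sup>2 \<partial>Q i) / (4 * lam)) - lam * (\<Sum>i\<in>I. S i)"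
    using quad lin by (intro diff_mono sum_mono) auto
  also have "\<dots> = 1 / (4 * lam) * (\<Sum>i\<in>I. \<integral>x. (1 - marg f i x)\<^sup>2 \<partial>Q i)"
    by (simp add: sum.distrib sum_distrib_left sum_divide_distrib)
  also have "1 / (4 * lam) = 2 * real (card I) * exp (3 * R + 2 * L)"
  proof -
    have "1 / (4 * lam) = 2 * n / exp (- (3 * R + 2 * L))" by (simp add: lam_def)
    also have "\<dots> = 2 * n * exp (3 * R + 2 * L)"
      by (simp only: nonzero_divide_eq_eq[OF exp_not_eq_zero] mult.assoc exp_minus_inverse mult_1_right)
    finally show ?thesis by (simp only: n_def)
  qed
  finally show ?thesis .
qed

text \<open>Almost everywhere \<open>tot v\<close> and \<open>tot f\<close> differ by the sum of the
  \<open>a i\<close>, which is zero; the means change by the same vanishing total.\<close>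

lemma shifted_dual:
  assumes f: "tot_bounded R f" and a: "(\<Sum>i\<in>I. a i) = 0"
    and v: "\<And>i. i \<in> I \<Longrightarrow> v i \<in> borel_measurable (Q i)"
    and eq: "\<And>i. i \<in> I \<Longrightarrow> AE x in Q i. v i x = f i x + a i"
  shows "integrable P (dens v)" "dual v = dual f"
proof -
  have "AE y in P. v i (y i) = f i (y i) + a i" if "i \<in> I" for i
    by (rule AE_PiM_component) (use prob_Q that eq in auto)
  then have "AE y in P. \<forall>i\<in>I. v i (y i) = f i (y i) + a i"
    using finite_I by (intro AE_finite_allI) auto
  then have ae: "AE y in P. dens v y = dens f y"
    by eventually_elim (simp add: dens_def tot_def sum.distrib a)
  have meas: "dens v \<in> borel_measurable P" "dens f \<in> borel_measurable P"
    using v tot_boundedD(1)[OF f] by (auto intro: dens_measurable)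
  show "integrable P (dens v)"
    using integrable_cong_AE[OF meas ae] dens_integrable[OF f] by simp
  have d: "(\<integral>y. dens v y \<partial>P) = (\<integral>y. dens f y \<partial>P)"
    by (rule integral_cong_AE[OF meas ae])
  have "(\<integral>x. v i x \<partial>Q i) = (\<integral>x. f i x \<partial>Q i) + a i" if i: "i \<in> I" for i
  proof -
    interpret prob_space "Q i" by (rule prob_Q[OF i])
    have "(\<integral>x. v i x \<partial>Q i) = (\<integral>x. f i x + a i \<partial>Q i)"
      using v[OF i] tot_boundedD(1)[OF f i] eq[OF i] by (intro integral_cong_AE) auto
    then show ?thesis using tot_bounded_integrable[OF f i] by (simp add: prob_space)
  qed
  then show "dual v = dual f" by (simp add: dual_def d sum.distrib a)
qed

text \<open>Unit marginals remove the linear part of the expansion and leave minus a nonnegative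
  divergence. Equality gives \<open>tot v = tot f\<close> only where \<open>k\<close> is positive;
  splitting this into statements about single coordinates takes the variance bound, whose right-hand
  side is then zero.\<close>

lemma fixed_point_optimal:
  assumes f: "tot_bounded R f" and one: "\<And>i x. i \<in> I \<Longrightarrow> x \<in> space (Q i) \<Longrightarrow> marg f i x = 1"
    and v: "\<And>i. i \<in> I \<Longrightarrow> integrable (Q i) (v i)" and dv: "integrable P (dens v)"
  shows "dual v \<le> dual f"
    and "dual v = dual f \<Longrightarrow>
      \<exists>a. (\<Sum>i\<in>I. a i) = 0 \<and> (\<forall>i\<in>I. AE x in Q i. v i x = f i x + a i)"
proof -
  let ?W = "\<lambda>y. tot v y - tot f y"
  let ?J = "\<lambda>y. dens f y * (exp (?W y) - 1 - ?W y)"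
  have "(\<integral>x. (v i x - f i x) * (1 - marg f i x) \<partial>Q i) = (\<integral>x. 0 \<partial>Q i)" if "i \<in> I" for i
    using one[OF that] by (intro Bochner_Integration.integral_cong) auto
  then have diff: "dual v - dual f = - (\<integral>y. ?J y \<partial>P)"
    using dual_diff(2)[OF f v dv] by simp
  have J: "0 \<le> ?J y" if "y \<in> space P" for y
  proof (rule mult_nonneg_nonneg[OF dens_nonneg[OF that]])
    show "0 \<le> exp (?W y) - 1 - ?W y" using exp_ge_add_one_self[of "?W y"] by linarith
  qed
  then have "0 \<le> (\<integral>y. ?J y \<partial>P)" by (intro integral_nonneg_AE AE_I2) auto
  then show "dual v \<le> dual f" using diff by simp
  assume "dual v = dual f"
  then have "(\<integral>y. ?J y \<partial>P) = 0" using diff by simp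
  then have "AE y in P. ?J y = 0"
    using integral_nonneg_eq_0_iff_AE[OF dual_diff(1)[OF f v dv]] J by auto
  then have ae: "AE y in P. (?W y)\<^sup>2 * k y = 0"
  proof eventually_elim
    case (elim y)
    have "?W y = 0" if "exp (?W y) - 1 - ?W y = 0"
    proof (rule ccontr)
      assume "?W y \<noteq> 0"
      then have "0 < exp (- \<bar>?W y\<bar>) * (?W y)\<^sup>2 / 2" by simp
      then show False using exp_ge_quadratic[of "?W y" "\<bar>?W y\<bar>"] that by linarith
    qed
    then show ?case using elim by (auto simp: dens_def)
  qed
  define w where "w = (\<lambda>i x. v i x - f i x)"
  have wm: "w i \<in> borel_measurable (Q i)" if "i \<in> I" for i
    using v[OF that] tot_boundedD(1)[OF f that] unfolding w_def by measurable
  have tw: "tot w y = ?W y" for y by (simp add: w_def tot_diff)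
  have "(\<integral>\<^sup>+ y. ennreal ((tot w y)\<^sup>2 * k y) \<partial>P) = (\<integral>\<^sup>+ y. 0 \<partial>P)"
    unfolding tw using ae by (intro nn_integral_cong_AE) (auto elim: eventually_mono)
  then have zero: "(\<integral>\<^sup>+ y. ennreal ((tot w y)\<^sup>2 * k y) \<partial>P) = 0" by simp
  have "\<forall>i\<in>I. \<exists>a. (\<integral>\<^sup>+ x. ennreal ((w i x - a)\<^sup>2) \<partial>Q i) = 0"
  proof
    fix i assume i: "i \<in> I"
    obtain a where "(\<integral>\<^sup>+ x. ennreal ((w i x - a)\<^sup>2) \<partial>Q i)
        \<le> ennreal (4 * exp (2 * L)) * (\<integral>\<^sup>+ y. ennreal ((tot w y)\<^sup>2 * k y) \<partial>P)"
      using coordinate_variance[OF wm i] by blast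
    then show "\<exists>a. (\<integral>\<^sup>+ x. ennreal ((w i x - a)\<^sup>2) \<partial>Q i) = 0"
      unfolding zero by auto
  qed
  from bchoice[OF this] obtain a where
    "\<forall>i\<in>I. (\<integral>\<^sup>+ x. ennreal ((w i x - a i)\<^sup>2) \<partial>Q i) = 0" ..
  then have a: "\<And>i. i \<in> I \<Longrightarrow> (\<integral>\<^sup>+ x. ennreal ((w i x - a i)\<^sup>2) \<partial>Q i) = 0" by blast
  have ai: "AE x in Q i. v i x = f i x + a i" if i: "i \<in> I" for i
  proof -
    note [measurable] = wm[OF i]
    have "AE x in Q i. ennreal ((w i x - a i)\<^sup>2) = 0"
      using a[OF i] by (subst (asm) nn_integral_0_iff_AE) auto
    then show ?thesis by eventually_elim (simp add: w_def)
  qed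
  have "AE y in P. v i (y i) = f i (y i) + a i" if "i \<in> I" for i
    by (rule AE_PiM_component) (use prob_Q that ai in auto)
  then have "AE y in P. \<forall>i\<in>I. v i (y i) = f i (y i) + a i"
    using finite_I by (intro AE_finite_allI) auto
  then have aeW: "AE y in P. ?W y = (\<Sum>i\<in>I. a i)"
    by eventually_elim (simp add: tot_def sum.distrib)
  \<comment> \<open>Where \<open>k\<close> is positive the sum vanishes. A nonzero sum would force
    \<open>k\<close>, hence \<open>dens f\<close>, to be zero almost everywhere, against unit
    mass.\<close>
  have "(\<Sum>i\<in>I. a i) = 0"
  proof (rule ccontr)
    assume neq: "(\<Sum>i\<in>I. a i) \<noteq> 0"
    from ae aeW have "AE y in P. dens f y = 0"
      by eventually_elim (use neq in \<open>auto simp: dens_def\<close>)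
    then have "(\<integral>y. dens f y \<partial>P) = 0" by (rule integral_eq_zero_AE)
    moreover obtain i where i: "i \<in> I" using I_nonempty by blast
    have "(\<integral>y. dens f y \<partial>P) = 1" by (rule integral_dens_eq_1[OF f i one[OF i]])
    ultimately show False by simp
  qed
  then show "\<exists>a. (\<Sum>i\<in>I. a i) = 0 \<and> (\<forall>i\<in>I. AE x in Q i. v i x = f i x + a i)"
    using ai by blast
qed

text \<open>A class of tuples preserved by the single-coordinate updates. Normalizing by the means
  is needed because a full sweep does not keep the individual means nonnegative.\<close>

definition admissible :: "('i \<Rightarrow> 'a \<Rightarrow> real) \<Rightarrow> bool" where
  "admissible f \<longleftrightarrow>
     (\<forall>i\<in>I. f i \<in> borel_measurable (Q i) \<and>
        (\<forall>x\<in>space (Q i). mean f i - card I * L \<le> f i x \<and> f i x \<le> mean f i + L)) \<and>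
     0 \<le> (\<Sum>i\<in>I. mean f i) \<and> (\<Sum>i\<in>I. mean f i) \<le> card I * L \<and> 0 \<le> dual f"

text \<open>The first term accounts for \<open>card I\<close> downward deviations of size
  \<open>card I * L\<close>, the second for the sum of the means plus \<open>card I\<close> upward
  deviations of size \<open>L\<close>.\<close>

definition radius :: real where
  "radius = card I * (card I * L) + 2 * (card I * L)"

lemma admissible_tot_bounded:
  assumes f: "admissible f"
  shows "tot_bounded radius f"
  unfolding tot_bounded_def
proof (intro conjI ballI)
  show "f i \<in> borel_measurable (Q i)" if "i \<in> I" for i
    using f that by (simp add: admissible_def)
next
  fix y assume y: "y \<in> space P"
  have "(\<Sum>i\<in>I. mean f i - card I * L) \<le> tot f y" "tot f y \<le> (\<Sum>i\<in>I. mean f i + L)"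
    unfolding tot_def using f component_space[OF y] by (auto intro!: sum_mono simp: admissible_def)
  moreover have "0 \<le> card I * L" "0 \<le> card I * (card I * L)"
    using L_nonneg by (auto simp del: of_nat_mult)
  ultimately show "\<bar>tot f y\<bar> \<le> radius"
    using f unfolding radius_def admissible_def sum_subtractf sum.distrib
    by (simp add: abs_le_iff; linarith)
qed

text \<open>With \<open>M\<close> the sum of the other means, the new value of the functional is
  \<open>mean g i + M\<close>. Since values increase from a nonnegative one,
  \<open>mean g i \<ge> - M\<close>, while Jensen gives \<open>g i \<le> L - M\<close>. Together
  these confine the mean to an interval of length \<open>L\<close>, so the deviations from it are
  bounded independently of the number of updates.\<close>

lemma admissible_step:
  assumes f: "admissible f" and i: "i \<in> I"
  shows "admissible (step f i)"
proof -
  interpret prob_space "Q i" by (rule prob_Q[OF i])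
  define g where "g = step f i"
  define M where "M = (\<Sum>j\<in>I - {i}. mean f j)"
  have fb: "tot_bounded radius f" by (rule admissible_tot_bounded[OF f])
  obtain R' where gb: "tot_bounded R' g" unfolding g_def using step_tot_bounded[OF fb i] by blast
  have one: "marg g i x = 1" if "x \<in> space (Q i)" for x
    unfolding g_def by (rule marg_step[OF fb i that])
  have other: "g j = f j" if "j \<noteq> i" for j using that by (simp add: g_def)
  have other_mean: "mean g j = mean f j" if "j \<noteq> i" for j using other[OF that] by (simp add: mean_def)
  have summean: "(\<Sum>j\<in>I. mean g j) = mean g i + M"
    using other_mean by (simp add: sum.remove[OF finite_I i] M_def)
  have card: "real (card (I - {i})) = real (card I) - 1"
    using card_Suc_Diff1[OF finite_I i] by linarith
  have dual: "dual f \<le> dual g"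
  proof -
    have "0 \<le> exp (- (radius + L)) / 2 * (\<integral>x. (g i x - f i x)\<^sup>2 \<partial>Q i)" by simp
    also have "\<dots> \<le> dual g - dual f" by (rule update_gain(1)[OF fb gb i other one])
    finally show ?thesis by simp
  qed
  moreover have dual_g: "dual g = mean g i + M"
    using dual_eq_sum_mean[OF gb i one] summean by simp
  moreover have "0 \<le> dual f" using f by (simp add: admissible_def)
  ultimately have mean_ge: "- M \<le> mean g i" by simp
  have up: "g i x \<le> L - M" if x: "x \<in> space (Q i)" for x
  proof -
    have "M - L \<le> ln (partition_fn f i x)"
      using partition_fn_ge[OF fb i x] partition_fn_pos[OF fb i x] by (simp add: M_def ln_ge_iff)
    then show ?thesis by (simp add: g_def step_def)
  qed
  \<comment> \<open>One \<open>L\<close> is lost per other coordinate; the last \<open>L\<close> in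
    \<open>card I * L\<close> is the slack in \<open>mean g i \<le> L - M\<close>.\<close>
  have lo: "- M - (real (card I) - 1) * L \<le> g i x" if x: "x \<in> space (Q i)" for x
  proof -
    have "off f i y \<le> M + (real (card I) - 1) * L" if y: "y \<in> space (P' i)" for y
    proof -
      have "off f i y \<le> (\<Sum>j\<in>I - {i}. mean f j + L)"
        unfolding off_def using f y by (intro sum_mono) (auto simp: admissible_def space_PiM)
      then show ?thesis by (simp add: sum.distrib M_def card)
    qed
    then have "partition_fn f i x \<le> exp (M + (real (card I) - 1) * L)"
      by (rule partition_fn_le[OF fb i x])
    then have "ln (partition_fn f i x) \<le> M + (real (card I) - 1) * L"
      using partition_fn_pos[OF fb i x] by (metis ln_exp ln_le_cancel_iff exp_gt_zero)
    then show ?thesis by (simp add: g_def step_def)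
  qed
  have mean_le: "mean g i \<le> L - M"
  proof -
    have "mean g i \<le> (\<integral>x. L - M \<partial>Q i)"
      unfolding mean_def using up by (intro integral_mono tot_bounded_integrable[OF gb i]) auto
    then show ?thesis by (simp add: prob_space)
  qed
  \<comment> \<open>After an update the sum of the means is at most \<open>L\<close>; the larger
    bound \<open>card I * L\<close> in the class leaves room for the initial tuple.\<close>
  have "1 \<le> card I" using finite_I I_nonempty by (simp add: Suc_leI card_gt_0_iff)
  then have cL: "L \<le> card I * L" using L_nonneg mult_right_mono[of 1 "real (card I)" L] by simp
  have "admissible g"
    unfolding admissible_def
  proof (intro conjI ballI)
    fix j assume j: "j \<in> I"
    show "g j \<in> borel_measurable (Q j)" by (rule tot_boundedD(1)[OF gb j])
    fix x assume x: "x \<in> space (Q j)"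
    show "mean g j - card I * L \<le> g j x"
    proof (cases "j = i")
      case True
      then show ?thesis using lo[of x] x mean_le by (simp add: left_diff_distrib)
    next
      case False
      then show ?thesis using f j x other[OF False] other_mean[OF False] by (simp add: admissible_def)
    qed
    show "g j x \<le> mean g j + L"
    proof (cases "j = i")
      case True
      then show ?thesis using up[of x] x mean_ge by simp
    next
      case False
      then show ?thesis using f j x other[OF False] other_mean[OF False] by (simp add: admissible_def)
    qed
  qed (use mean_ge mean_le summean cL dual_g in auto)
  then show ?thesis by (simp add: g_def)
qed

end

section \<open>Geometric convergence of the cyclic updates\<close>

text \<open>\<open>f_outside\<close> freezes the irrelevant coordinates, so that a sweep starts at
  \<open>f n\<close> and ends at \<open>f (Suc n)\<close> as functions on all indices and not merely
  on \<open>{1..N}\<close>.\<close>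

locale gibbs_sweep = gibbs_kernel "{1..N}" Q k L
  for N :: nat and Q :: "nat \<Rightarrow> 'a measure" and k L +
  fixes f :: "nat \<Rightarrow> nat \<Rightarrow> 'a \<Rightarrow> real"
  assumes admissible_0: "admissible (f 0)"
    and f_outside: "\<And>n j. j \<notin> {1..N} \<Longrightarrow> f (Suc n) j = f n j"
    and f_Suc: "\<And>n i. i \<in> {1..N} \<Longrightarrow>
      f (Suc n) i = (\<lambda>x. - ln (partition_fn (\<lambda>j. if j < i then f (Suc n) j else f n j) i x))"
begin

declare One_nat_def [simp del]

section \<open>Intermediate states and increments of a sweep\<close>

definition partial :: "nat \<Rightarrow> nat \<Rightarrow> nat \<Rightarrow> 'a \<Rightarrow> real" where
  "partial n i = (\<lambda>j. if j \<le> i then f (Suc n) j else f n j)"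

definition incr :: "nat \<Rightarrow> nat \<Rightarrow> 'a \<Rightarrow> real" where
  "incr n i x = f (Suc n) i x - f n i x"

definition energy :: "nat \<Rightarrow> real" where
  "energy n = (\<Sum>i\<in>{1..N}. \<integral>x. (incr n i x)\<^sup>2 \<partial>Q i)"

lemma N_pos: "0 < N"
  using I_nonempty by auto

lemma partial_0: "partial n 0 = f n"
  using f_outside[of 0 n] by (auto simp: partial_def)

lemma partial_N: "partial n N = f (Suc n)"
  using f_outside[of _ n] by (auto simp: partial_def fun_eq_iff)

lemma partial_step:
  assumes "i \<in> {1..N}"
  shows "partial n i = step (partial n (i - 1)) i"
proof
  fix j
  have "partial n (i - 1) = (\<lambda>j. if j < i then f (Suc n) j else f n j)"
    using assms by (auto simp: partial_def fun_eq_iff)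
  then show "partial n i j = step (partial n (i - 1)) i j"
    using assms f_Suc[OF assms, of n] by (auto simp: partial_def step_def)
qed

lemma admissible_partial:
  assumes "admissible (f n)" "i \<le> N"
  shows "admissible (partial n i)"
  using assms(2)
proof (induction i)
  case 0
  then show ?case using assms(1) by (simp add: partial_0)
next
  case (Suc i)
  then show ?case using partial_step[of "Suc i" n] admissible_step[of "partial n i" "Suc i"] by simp
qed

lemma admissible_f: "admissible (f n)"
proof (induction n)
  case 0
  show ?case by (rule admissible_0)
next
  case (Suc n)
  then show ?case using admissible_partial[of n N] by (simp add: partial_N)
qed

lemma f_tot_bounded: "tot_bounded radius (f n)"
  by (rule admissible_tot_bounded[OF admissible_f])

lemma partial_tot_bounded: "i \<le> N \<Longrightarrow> tot_bounded radius (partial n i)"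
  by (intro admissible_tot_bounded admissible_partial admissible_f)

lemma marg_partial:
  assumes "i \<in> {1..N}" "x \<in> space (Q i)"
  shows "marg (partial n i) i x = 1"
  unfolding partial_step[OF assms(1)]
  using assms by (intro marg_step[OF partial_tot_bounded]) auto

text \<open>Just before its update the \<open>i\<close>-th marginal encodes the coming increment
  exactly. This makes marginal defects and increments interchangeable below.\<close>

lemma
  assumes i: "i \<in> {1..N}" and x: "x \<in> space (Q i)"
  shows marg_partial_before: "marg (partial n (i - 1)) i x = exp (- incr n i x)"
    and incr_bounded: "\<bar>incr n i x\<bar> \<le> radius + L"
proof -
  have tb: "tot_bounded radius (partial n (i - 1))" using i by (intro partial_tot_bounded) auto
  have other: "partial n i j = partial n (i - 1) j" if "j \<in> {1..N}" "j \<noteq> i" for j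
    using that i by (auto simp: partial_def)
  have "partial n i i x - partial n (i - 1) i x = incr n i x"
    using i by (auto simp: partial_def incr_def)
  then show "marg (partial n (i - 1)) i x = exp (- incr n i x)" "\<bar>incr n i x\<bar> \<le> radius + L"
    using update_marg[OF tb i x other marg_partial[OF i x]] by auto
qed

lemma
  assumes i: "i \<in> {1..N}"
  shows incr_gain: "exp (- (radius + L)) / 2 * (\<integral>x. (incr n i x)\<^sup>2 \<partial>Q i)
      \<le> dual (partial n i) - dual (partial n (i - 1))"
    and incr_square_integrable: "integrable (Q i) (\<lambda>x. (incr n i x)\<^sup>2)"
proof -
  have tb: "tot_bounded radius (partial n (i - 1))" "tot_bounded radius (partial n i)"
    using i by (auto intro!: partial_tot_bounded)
  have other: "partial n i j = partial n (i - 1) j" if "j \<in> {1..N}" "j \<noteq> i" for j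
    using that i by (auto simp: partial_def)
  have "partial n i i x - partial n (i - 1) i x = incr n i x" for x
    using i by (auto simp: partial_def incr_def)
  then show "exp (- (radius + L)) / 2 * (\<integral>x. (incr n i x)\<^sup>2 \<partial>Q i)
      \<le> dual (partial n i) - dual (partial n (i - 1))"
    "integrable (Q i) (\<lambda>x. (incr n i x)\<^sup>2)"
    using update_gain[OF tb i other marg_partial[OF i]] by auto
qed

text \<open>The gains of the single updates telescope along the intermediate states
  \<open>partial n 0\<close>, ..., \<open>partial n N\<close>.\<close>

lemma energy_le_gain: "energy n \<le> 2 * exp (radius + L) * (dual (f (Suc n)) - dual (f n))"
proof -
  let ?c = "exp (- (radius + L)) / 2"
  have "?c * (\<Sum>i\<in>{1..m}. \<integral>x. (incr n i x)\<^sup>2 \<partial>Q i) \<le> dual (partial n m) - dual (partial n 0)"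
    if "m \<le> N" for m
    using that
  proof (induction m)
    case (Suc m)
    have "{1..Suc m} = insert (Suc m) {1..m}" by auto
    then show ?case using Suc incr_gain[of "Suc m" n] by (simp add: distrib_left)
  qed simp
  from this[of N] have "?c * energy n \<le> dual (f (Suc n)) - dual (f n)"
    by (simp add: energy_def partial_0 partial_N)
  then have "(2 * exp (radius + L)) * (?c * energy n)
      \<le> 2 * exp (radius + L) * (dual (f (Suc n)) - dual (f n))"
    by (intro mult_left_mono) auto
  moreover have "(2 * exp (radius + L)) * (?c * energy n)
      = (exp (radius + L) * exp (- (radius + L))) * energy n" by simp
  ultimately show ?thesis by (simp only: exp_minus_inverse mult_1_left)
qed

section \<open>From energies to marginal defects and geometric decay\<close>

lemma energy_component: "i \<in> {1..N} \<Longrightarrow> (\<integral>x. (incr n i x)\<^sup>2 \<partial>Q i) \<le> energy n"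
  unfolding energy_def by (rule member_le_sum) auto

lemma energy_nonneg: "0 \<le> energy n"
  unfolding energy_def by (intro sum_nonneg) auto

text \<open>Cauchy-Schwarz on a probability space, obtained from the nonnegativity of the variance
  of \<open>\<bar>incr n i x\<bar>\<close>.\<close>

lemma integral_incr_le:
  assumes i: "i \<in> {1..N}"
  shows "(\<integral>x. \<bar>incr n i x\<bar> \<partial>Q i) \<le> sqrt (energy n)"
proof -
  interpret prob_space "Q i" by (rule prob_Q[OF i])
  define c where "c = (\<integral>x. \<bar>incr n i x\<bar> \<partial>Q i)"
  have int: "integrable (Q i) (\<lambda>x. \<bar>incr n i x\<bar>)"
    using tot_bounded_integrable[OF f_tot_bounded i] unfolding incr_def
    by (intro integrable_abs Bochner_Integration.integrable_diff) auto
  have "0 \<le> (\<integral>x. (\<bar>incr n i x\<bar> - c)\<^sup>2 \<partial>Q i)" by simp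
  also have "\<dots> = (\<integral>x. (incr n i x)\<^sup>2 - (2 * c) * \<bar>incr n i x\<bar> + c\<^sup>2 \<partial>Q i)"
    by (simp add: power2_diff algebra_simps)
  also have "\<dots> = (\<integral>x. (incr n i x)\<^sup>2 \<partial>Q i) - (2 * c) * c + c\<^sup>2"
    using int incr_square_integrable[OF i, of n] by (simp add: c_def prob_space)
  finally have "c\<^sup>2 \<le> (\<integral>x. (incr n i x)\<^sup>2 \<partial>Q i)"
    by (simp add: power2_eq_square)
  also have "\<dots> \<le> energy n" by (rule energy_component[OF i])
  finally show ?thesis unfolding c_def by (rule real_le_rsqrt)
qed

text \<open>At \<open>partial n (i - 1)\<close> the marginal is \<open>exp (- incr n i x)\<close>.
  Going back to \<open>f n\<close> undoes the earlier updates of the sweep, each at the price of its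
  increment in mean; coordinate \<open>i\<close> is the same in both tuples, so no further pointwise
  term appears.\<close>

lemma marg_defect:
  assumes i: "i \<in> {1..N}" and x: "x \<in> space (Q i)"
  shows "\<bar>1 - marg (f n) i x\<bar>
    \<le> exp (radius + L) * \<bar>incr n i x\<bar> + exp radius * (N * sqrt (energy n))"
proof -
  have le: "i - 1 \<le> N" using i by auto
  have "\<bar>1 - marg (partial n (i - 1)) i x\<bar> \<le> exp (radius + L) * \<bar>incr n i x\<bar>"
    using abs_exp_diff_le[of 0 "radius + L" "- incr n i x"] incr_bounded[OF i x, of n]
    by (simp add: marg_partial_before[OF i x] abs_le_iff)
  moreover have "\<bar>marg (partial n (i - 1)) i x - marg (f n) i x\<bar> \<le> exp radius * (N * sqrt (energy n))"
  proof -
    have "(\<integral>x. \<bar>partial n (i - 1) j x - f n j x\<bar> \<partial>Q j) \<le> sqrt (energy n)" if "j \<in> {1..N}" for j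
      using integral_incr_le[OF that, of n] energy_nonneg[of n]
      by (auto simp: partial_def incr_def)
    then have "(\<Sum>j\<in>{1..N} - {i}. \<integral>x. \<bar>partial n (i - 1) j x - f n j x\<bar> \<partial>Q j)
        \<le> (\<Sum>j\<in>{1..N} - {i}. sqrt (energy n))"
      by (intro sum_mono) auto
    also have "\<dots> \<le> N * sqrt (energy n)"
      using energy_nonneg[of n] i by (auto intro!: mult_right_mono)
    moreover have "partial n (i - 1) i x = f n i x" using i by (auto simp: partial_def)
    ultimately show ?thesis
      using marg_lipschitz[OF partial_tot_bounded[OF le] f_tot_bounded i x, of n n]
        mult_left_mono[of _ "N * sqrt (energy n)" "exp radius"]
      by (smt (verit) exp_gt_zero)
  qed
  ultimately show ?thesis by linarith
qed

text \<open>The square root of the energy is squared back, so the bound is linear in the energy.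
  Linearity is what yields a geometric rate.\<close>

lemma sum_marg_defect:
  obtains C where "0 \<le> C"
    "\<And>n. (\<Sum>i\<in>{1..N}. \<integral>x. (1 - marg (f n) i x)\<^sup>2 \<partial>Q i) \<le> C * energy n"
proof
  define C1 where "C1 = 2 * (exp (radius + L))\<^sup>2"
  define C2 where "C2 = 2 * (exp radius)\<^sup>2 * (real N)\<^sup>2"
  show "0 \<le> C1 + N * C2" by (simp add: C1_def C2_def)
  fix n
  have "(\<integral>x. (1 - marg (f n) i x)\<^sup>2 \<partial>Q i) \<le> C1 * (\<integral>x. (incr n i x)\<^sup>2 \<partial>Q i) + C2 * energy n"
    if i: "i \<in> {1..N}" for i
  proof -
    interpret prob_space "Q i" by (rule prob_Q[OF i])
    define m where "m = marg (f n) i"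
    have [measurable]: "m \<in> borel_measurable (Q i)"
      unfolding m_def using f_tot_bounded[of n] i by (intro marg_measurable) (auto dest: tot_boundedD)
    have [measurable]: "integrable (Q i) (\<lambda>x. (incr n i x)\<^sup>2)" by (rule incr_square_integrable[OF i])
    have pt: "(1 - m x)\<^sup>2 \<le> C1 * (incr n i x)\<^sup>2 + C2 * energy n" if x: "x \<in> space (Q i)" for x
    proof -
      let ?a = "exp (radius + L) * \<bar>incr n i x\<bar>" and ?b = "exp radius * (N * sqrt (energy n))"
      have "(1 - m x)\<^sup>2 \<le> (?a + ?b)\<^sup>2"
        using marg_defect[OF i x, of n] energy_nonneg[of n] unfolding m_def
        by (simp flip: abs_le_square_iff)
      also have "\<dots> \<le> 2 * ?a\<^sup>2 + 2 * ?b\<^sup>2"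
        using zero_le_power2[of "?a - ?b"] unfolding power2_diff power2_sum by linarith
      also have "\<dots> = C1 * (incr n i x)\<^sup>2 + C2 * energy n"
        using energy_nonneg[of n] by (simp add: C1_def C2_def power_mult_distrib)
      finally show ?thesis .
    qed
    have int: "integrable (Q i) (\<lambda>x. C1 * (incr n i x)\<^sup>2 + C2 * energy n)"
      using incr_square_integrable[OF i, of n] by simp
    have "(\<integral>x. (1 - m x)\<^sup>2 \<partial>Q i) \<le> (\<integral>x. C1 * (incr n i x)\<^sup>2 + C2 * energy n \<partial>Q i)"
    proof (intro integral_mono int pt)
      show "integrable (Q i) (\<lambda>x. (1 - m x)\<^sup>2)"
        using pt energy_nonneg[of n]
        by (intro Bochner_Integration.integrable_bound[OF int] AE_I2) (auto simp: C1_def C2_def)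
    qed
    also have "\<dots> = C1 * (\<integral>x. (incr n i x)\<^sup>2 \<partial>Q i) + C2 * energy n"
      using incr_square_integrable[OF i, of n] by (simp add: prob_space)
    finally show ?thesis by (simp add: m_def)
  qed
  then have "(\<Sum>i\<in>{1..N}. \<integral>x. (1 - marg (f n) i x)\<^sup>2 \<partial>Q i)
      \<le> (\<Sum>i\<in>{1..N}. C1 * (\<integral>x. (incr n i x)\<^sup>2 \<partial>Q i) + C2 * energy n)"
    by (rule sum_mono)
  also have "\<dots> = (C1 + N * C2) * energy n"
    by (simp add: sum.distrib energy_def sum_distrib_left[symmetric] algebra_simps)
  finally show "(\<Sum>i\<in>{1..N}. \<integral>x. (1 - marg (f n) i x)\<^sup>2 \<partial>Q i) \<le> (C1 + N * C2) * energy n" .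
qed

text \<open>A sweep ends with the update of coordinate \<open>N\<close>, which normalizes the mass.
  The initial tuple carries no such normalization, hence the index shift in the decay
  estimates.\<close>

lemma mass_Suc: "(\<integral>y. dens (f (Suc n)) y \<partial>P) = 1"
proof -
  have N: "N \<in> {1..N}" using N_pos by auto
  show ?thesis
    unfolding partial_N[symmetric]
    by (rule integral_dens_eq_1[OF partial_tot_bounded N marg_partial[OF N]]) auto
qed

text \<open>A closed loop: the gap is bounded by the defects, these by the energy of the coming
  sweep, and that energy by the gain of the same sweep.\<close>

lemma energy_geometric:
  obtains B q where "0 \<le> B" "0 < q" "q < 1" "\<And>n. energy (Suc n) \<le> B * q ^ n"
proof -
  obtain C where C: "0 \<le> C" "\<And>n. (\<Sum>i\<in>{1..N}. \<integral>x. (1 - marg (f n) i x)\<^sup>2 \<partial>Q i) \<le> C * energy n"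
    by (rule sum_marg_defect) (rule that; blast)
  define C0 where "C0 = 2 * real (card {1..N}) * exp (3 * radius + 2 * L)"
  have C0: "0 \<le> C0" by (simp add: C0_def)
  define e where "e = 2 * exp (radius + L)"
  have e: "e > 0" by (simp add: e_def)
  define g where "g = (\<lambda>n. dual (f (Suc n)))"
  have mono: "g n \<le> g (Suc n)" for n
  proof -
    have "0 \<le> e * (g (Suc n) - g n)"
      using energy_le_gain[of "Suc n"] energy_nonneg[of "Suc n"] unfolding g_def e_def by linarith
    then show ?thesis using e by (simp add: zero_le_mult_iff)
  qed
  have gap: "g m - g n \<le> (C0 * C * e) * (g (Suc n) - g n)" for m n
  proof -
    have "g m - g n \<le> C0 * (\<Sum>i\<in>{1..N}. \<integral>x. (1 - marg (f (Suc n)) i x)\<^sup>2 \<partial>Q i)"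
      unfolding g_def C0_def by (rule dual_gap[OF f_tot_bounded f_tot_bounded mass_Suc])
    also have "\<dots> \<le> C0 * (C * energy (Suc n))"
      by (intro mult_left_mono C C0)
    also have "\<dots> \<le> C0 * (C * (e * (g (Suc n) - g n)))"
      using energy_le_gain[of "Suc n"] unfolding g_def e_def by (intro mult_left_mono C C0)
    finally show ?thesis by (simp add: mult.assoc)
  qed
  obtain B q where Bq: "0 \<le> B" "0 < q" "q < 1" "\<And>n. g (Suc n) - g n \<le> B * q ^ n"
    by (rule geometric_increments[of g, OF mono gap]) (rule that; blast)
  have "energy (Suc n) \<le> (e * B) * q ^ n" for n
  proof -
    have "energy (Suc n) \<le> e * (g (Suc n) - g n)"
      using energy_le_gain[of "Suc n"] unfolding g_def e_def .
    also have "\<dots> \<le> e * (B * q ^ n)" using e by (intro mult_left_mono Bq) auto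
    finally show ?thesis by (simp add: mult.assoc)
  qed
  then show ?thesis using that[of "e * B" q] Bq e by simp
qed

text \<open>The tuples \<open>partial n i\<close> and \<open>partial (Suc n) (i - 1)\<close> agree in coordinate \<open>i\<close>, so their
  \<open>i\<close>-th marginals are uniformly close once the increments are small in mean.\<close>

lemma incr_le_energy:
  assumes i: "i \<in> {1..N}" and x: "x \<in> space (Q i)"
  shows "\<bar>incr (Suc n) i x\<bar>
    \<le> exp (radius + L) * (exp radius * (N * (sqrt (energy n) + sqrt (energy (Suc n)))))"
proof -
  let ?s = "sqrt (energy n) + sqrt (energy (Suc n))"
  have le: "i - 1 \<le> N" "i \<le> N" using i by auto
  have "(\<integral>x. \<bar>partial n i j x - partial (Suc n) (i - 1) j x\<bar> \<partial>Q j) \<le> ?s" if "j \<in> {1..N} - {i}" for j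
  \<comment> \<open>For \<open>j < i\<close> the two tuples hold the iterates \<open>n + 1\<close>
    and \<open>n + 2\<close> of coordinate \<open>j\<close>, for \<open>j > i\<close> the iterates
    \<open>n\<close> and \<open>n + 1\<close>; hence both energies.\<close>
  proof (cases "j < i")
    case True
    then have "\<bar>partial n i j x - partial (Suc n) (i - 1) j x\<bar> = \<bar>incr (Suc n) j x\<bar>" for x
      by (auto simp: partial_def incr_def)
    then show ?thesis using add_increasing[OF real_sqrt_ge_zero[OF energy_nonneg[of n]] integral_incr_le[of j "Suc n"]] that
      by simp
  next
    case False
    then have "\<bar>partial n i j x - partial (Suc n) (i - 1) j x\<bar> = \<bar>incr n j x\<bar>" for x
      using that by (auto simp: partial_def incr_def)
    then show ?thesis using add_increasing2[OF real_sqrt_ge_zero[OF energy_nonneg[of "Suc n"]] integral_incr_le[of j n]] that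
      by simp
  qed
  then have "(\<Sum>j\<in>{1..N} - {i}. \<integral>x. \<bar>partial n i j x - partial (Suc n) (i - 1) j x\<bar> \<partial>Q j)
      \<le> (\<Sum>j\<in>{1..N} - {i}. ?s)"
    by (intro sum_mono) auto
  also have "\<dots> \<le> N * ?s"
    using energy_nonneg i by (auto intro!: mult_right_mono add_nonneg_nonneg)
  finally have s: "(\<Sum>j\<in>{1..N} - {i}. \<integral>x. \<bar>partial n i j x - partial (Suc n) (i - 1) j x\<bar> \<partial>Q j)
      \<le> N * ?s" .
  have "partial n i i x = partial (Suc n) (i - 1) i x" using i by (auto simp: partial_def)
  then have "\<bar>marg (partial n i) i x - marg (partial (Suc n) (i - 1)) i x\<bar> \<le> exp radius
      * (\<Sum>j\<in>{1..N} - {i}. \<integral>x. \<bar>partial n i j x - partial (Suc n) (i - 1) j x\<bar> \<partial>Q j)"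
    using marg_lipschitz[OF partial_tot_bounded[OF le(2)] partial_tot_bounded[OF le(1)] i x, of n "Suc n"]
    by simp
  also have "\<dots> \<le> exp radius * (N * ?s)" using s by (intro mult_left_mono) auto
  \<comment> \<open>The first marginal is one by normalization, the second is
    \<open>exp (- incr (Suc n) i x)\<close>.\<close>
  finally have m: "\<bar>1 - exp (- incr (Suc n) i x)\<bar> \<le> exp radius * (N * ?s)"
    by (simp add: marg_partial[OF i x] marg_partial_before[OF i x])
  have "\<bar>incr (Suc n) i x\<bar> \<le> exp (radius + L) * \<bar>1 - exp (- incr (Suc n) i x)\<bar>"
    by (rule abs_le_exp_diff_one[OF incr_bounded[OF i x]])
  also have "\<dots> \<le> exp (radius + L) * (exp radius * (N * ?s))"
    using m by (intro mult_left_mono) auto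
  finally show ?thesis .
qed

text \<open>Energies are squared norms, so their ratio \<open>q\<close> becomes
  \<open>sqrt q\<close>. The offset 2 arises because \<open>incr (Suc n)\<close> is controlled by
  the energies \<open>n\<close> and \<open>n + 1\<close>, whose decay starts at index 1.\<close>

lemma incr_geometric:
  obtains B r where "0 < r" "r < 1"
    "\<And>n i x. i \<in> {1..N} \<Longrightarrow> x \<in> space (Q i) \<Longrightarrow> \<bar>incr (n + 2) i x\<bar> \<le> B * r ^ n"
proof -
  obtain B q where Bq: "0 \<le> B" "0 < q" "q < 1" "\<And>n. energy (Suc n) \<le> B * q ^ n"
    by (rule energy_geometric) (rule that; blast)
  define M where "M = exp (radius + L) * (exp radius * real N)"
  have M: "0 \<le> M" by (simp add: M_def)
  have sq: "sqrt (energy (Suc n)) \<le> sqrt B * sqrt q ^ n" for n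
    using real_sqrt_le_mono[OF Bq(4)[of n]] by (simp add: real_sqrt_mult real_sqrt_power)
  have "\<bar>incr (n + 2) i x\<bar> \<le> (M * 2 * sqrt B) * sqrt q ^ n"
    if i: "i \<in> {1..N}" and x: "x \<in> space (Q i)" for n i x
  proof -
    have "\<bar>incr (n + 2) i x\<bar> \<le> M * (sqrt (energy (Suc n)) + sqrt (energy (Suc (Suc n))))"
      using incr_le_energy[OF i x, of "Suc n"] by (simp add: M_def mult.assoc)
    also have "\<dots> \<le> M * (sqrt B * sqrt q ^ n + sqrt B * sqrt q ^ n)"
    proof (intro mult_left_mono add_mono M sq)
      have "sqrt B * sqrt q ^ Suc n \<le> sqrt B * sqrt q ^ n"
        using Bq by (intro mult_left_mono power_decreasing) auto
      then show "sqrt (energy (Suc (Suc n))) \<le> sqrt B * sqrt q ^ n"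
        using sq[of "Suc n"] by linarith
    qed
    finally show ?thesis by simp
  qed
  then show ?thesis using that[of "sqrt q" "M * 2 * sqrt B"] Bq by simp
qed

lemma converges:
  obtains g where "\<And>i. i \<in> {1..N} \<Longrightarrow> uniform_limit (space (Q i)) (\<lambda>n. f n i) (g i) sequentially"
    "tot_bounded radius g" "\<And>i x. i \<in> {1..N} \<Longrightarrow> x \<in> space (Q i) \<Longrightarrow> marg g i x = 1"
proof -
  obtain B r where r: "0 < r" "r < 1"
    and B: "\<And>n i x. i \<in> {1..N} \<Longrightarrow> x \<in> space (Q i) \<Longrightarrow> \<bar>incr (n + 2) i x\<bar> \<le> B * r ^ n"
    by (rule incr_geometric) (rule that; blast)
  define g where "g = (\<lambda>i x. f 2 i x + (\<Sum>n. incr (n + 2) i x))"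
  have telescope: "f (m + 2) i x = f 2 i x + (\<Sum>n<m. incr (n + 2) i x)" for m i x
    by (induction m) (auto simp: incr_def numeral_2_eq_2)
  have unif: "uniform_limit (space (Q i)) (\<lambda>n. f n i) (g i) sequentially" if i: "i \<in> {1..N}" for i
  proof -
    have "uniform_limit (space (Q i)) (\<lambda>m x. \<Sum>n<m. incr (n + 2) i x) (\<lambda>x. \<Sum>n. incr (n + 2) i x) sequentially"
    proof (rule Weierstrass_m_test)
      show "norm (incr (n + 2) i x) \<le> B * r ^ n" if "x \<in> space (Q i)" for n x
        using B[OF i that] by simp
      show "summable (\<lambda>n. B * r ^ n)" using r by (intro summable_mult summable_geometric) auto
    qed
    then have "uniform_limit (space (Q i)) (\<lambda>m. f (m + 2) i) (g i) sequentially"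
      unfolding uniform_limit_iff g_def telescope by (simp add: dist_norm)
    then show ?thesis
      unfolding uniform_limit_iff
      using eventually_sequentially_seg[of "\<lambda>n. \<forall>x\<in>space (Q i). dist (f n i x) (g i x) < e" 2 for e]
      by blast
  qed
  have lim: "(\<lambda>n. f n i x) \<longlonglongrightarrow> g i x" if "i \<in> {1..N}" "x \<in> space (Q i)" for i x
    using tendsto_uniform_limitI[OF unif[OF that(1)] that(2)] .
  have gb: "tot_bounded radius g"
    unfolding tot_bounded_def
  proof (intro conjI ballI)
    fix i assume i: "i \<in> {1..N}"
    show "g i \<in> borel_measurable (Q i)"
      by (rule borel_measurable_LIMSEQ_real[where u = "\<lambda>n. f n i"])
         (fact lim[OF i], fact tot_boundedD(1)[OF f_tot_bounded i])
  next
    fix y assume y: "y \<in> space P"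
    have "(\<lambda>n. \<bar>tot (f n) y\<bar>) \<longlonglongrightarrow> \<bar>tot g y\<bar>"
      unfolding tot_def using lim component_space[OF y] by (intro tendsto_rabs tendsto_sum) auto
    then show "\<bar>tot g y\<bar> \<le> radius"
      by (rule LIMSEQ_le_const2) (use tot_boundedD(2)[OF f_tot_bounded y] in auto)
  qed
  have one: "marg g i x = 1" if i: "i \<in> {1..N}" and x: "x \<in> space (Q i)" for i x
  proof -
    \<comment> \<open>The comparison tuple is \<open>partial n i\<close>, whose \<open>i\<close>-th
      marginal is exactly one. Its coordinates are taken from \<open>f n\<close> and
      \<open>f (Suc n)\<close>, both uniformly close to \<open>g\<close>.\<close>
    have small: "\<bar>marg g i x - 1\<bar> \<le> e" if e: "0 < e" for e
    proof -
      \<comment> \<open>After the Lipschitz factor \<open>exp radius\<close>, the error is shared by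
        coordinate \<open>i\<close> and at most \<open>N\<close> averaged coordinates.\<close>
      define d where "d = e / (exp radius * (1 + real N))"
      have d: "0 < d" using e by (simp add: d_def)
      have "\<forall>\<^sub>F n in sequentially. \<forall>j\<in>{1..N}. \<forall>x\<in>space (Q j). dist (f n j x) (g j x) < d"
        using unif d by (intro eventually_ball_finite) (auto simp: uniform_limit_iff)
      then obtain n where n: "\<And>m j x. m \<ge> n \<Longrightarrow> j \<in> {1..N} \<Longrightarrow> x \<in> space (Q j) \<Longrightarrow> dist (f m j x) (g j x) < d"
        unfolding eventually_sequentially by blast
      have close: "\<bar>g j x - partial n i j x\<bar> \<le> d" if "j \<in> {1..N}" "x \<in> space (Q j)" for j x
        using n[of n, OF _ that] n[of "Suc n", OF _ that]
        by (auto simp: partial_def dist_real_def abs_minus_commute less_imp_le)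
      have pb: "tot_bounded radius (partial n i)" using i by (intro partial_tot_bounded) auto
      have "(\<integral>x. \<bar>g j x - partial n i j x\<bar> \<partial>Q j) \<le> d" if j: "j \<in> {1..N}" for j
      proof -
        interpret prob_space "Q j" by (rule prob_Q[OF j])
        have "(\<integral>x. \<bar>g j x - partial n i j x\<bar> \<partial>Q j) \<le> (\<integral>x. d \<partial>Q j)"
          using close[OF j] tot_bounded_integrable[OF gb j] tot_bounded_integrable[OF pb j]
          by (intro integral_mono integrable_abs Bochner_Integration.integrable_diff) auto
        then show ?thesis by (simp add: prob_space)
      qed
      then have "(\<Sum>j\<in>{1..N} - {i}. \<integral>x. \<bar>g j x - partial n i j x\<bar> \<partial>Q j) \<le> (\<Sum>j\<in>{1..N} - {i}. d)"
        by (intro sum_mono) auto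
      also have "\<dots> \<le> N * d" using i d by (auto intro!: mult_right_mono)
      finally have "\<bar>g i x - partial n i i x\<bar> + (\<Sum>j\<in>{1..N} - {i}. \<integral>x. \<bar>g j x - partial n i j x\<bar> \<partial>Q j)
          \<le> (1 + real N) * d"
        using close[OF i x] by (simp add: distrib_right)
      then have "exp radius * (\<bar>g i x - partial n i i x\<bar>
            + (\<Sum>j\<in>{1..N} - {i}. \<integral>x. \<bar>g j x - partial n i j x\<bar> \<partial>Q j))
          \<le> exp radius * ((1 + real N) * d)"
        by (rule mult_left_mono) simp
      also have "\<dots> = e"
        using add_pos_nonneg[of 1 "real N"] by (simp add: d_def)
      finally show ?thesis
        using marg_lipschitz[OF gb pb i x] marg_partial[OF i x, of n] by simp
    qed
    have "\<bar>marg g i x - 1\<bar> \<le> 0" by (rule field_le_epsilon) (use small in auto)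
    then show ?thesis by simp
  qed
  show ?thesis by (rule that[OF unif gb one])
qed

end

section \<open>Measurability of lower semicontinuous costs\<close>

text \<open>Balls of radius \<open>1 / (n + 1)\<close> around a countable dense set form a base; a
  radius below \<open>r / 2\<close> keeps such a ball inside \<open>mball x r\<close>.\<close>

lemma polish_topology_second_countable:
  assumes "polish_topology X"
  shows "second_countable X"
proof -
  obtain M d where "Metric_space M d" and X: "X = Metric_space.mtopology M d"
    using assms completely_metrizable_imp_metrizable_space
    unfolding polish_topology_def metrizable_space_def by metis
  then interpret Metric_space M d by simp
  obtain C where C: "countable C" "C \<subseteq> M" "mtopology closure_of C = M"
    using assms unfolding polish_topology_def separable_space_def X topspace_mtopology by blast
  let ?B = "(\<lambda>(c, n). mball c (inverse (real (Suc n)))) ` (C \<times> UNIV)"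
  show ?thesis
    unfolding second_countable_def
  proof (intro exI conjI allI impI ballI)
    show "countable ?B" using C(1) by auto
    show "openin X V" if "V \<in> ?B" for V using that by (auto simp: X)
    fix U x assume U: "openin X U \<and> x \<in> U"
    then obtain r where r: "r > 0" "mball x r \<subseteq> U" and xM: "x \<in> M"
      unfolding X openin_mtopology by blast
    obtain n where n: "inverse (real (Suc n)) < r / 2"
      using reals_Archimedean[of "r / 2"] r(1) by auto
    have "x \<in> mtopology closure_of C" using C(3) xM by simp
    then obtain c where c: "c \<in> C" "c \<in> mball x (inverse (real (Suc n)))"
      unfolding metric_closure_of by (auto dest!: spec[of _ "inverse (real (Suc n))"])
    have sub: "mball c (inverse (real (Suc n))) \<subseteq> mball x r"
    proof
      fix z assume z: "z \<in> mball c (inverse (real (Suc n)))"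
      then have "d x z \<le> d x c + d c z" using c C(2) xM by (intro triangle) auto
      then show "z \<in> mball x r" using z c n xM by auto
    qed
    show "\<exists>V\<in>?B. x \<in> V \<and> V \<subseteq> U"
    proof (intro bexI conjI)
      show "x \<in> mball c (inverse (real (Suc n)))" using c xM by (auto simp: commute)
      show "mball c (inverse (real (Suc n))) \<subseteq> U" using sub r by blast
      show "mball c (inverse (real (Suc n))) \<in> ?B" using c by (auto intro!: image_eqI[of _ _ "(c, n)"])
    qed
  qed
qed

lemma space_borel_of: "space (borel_of X) = topspace X"
  unfolding borel_of_def by (intro space_measure_of) (auto dest: openin_subset)

lemma openin_sets_borel_of: "openin X U \<Longrightarrow> U \<in> sets (borel_of X)"
  unfolding borel_of_def by (subst sets_measure_of) (auto dest: openin_subset)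

text \<open>Second countable factors make an open set of the product a countable union of open
  boxes; in general the product sigma-algebra can miss open sets.\<close>

lemma openin_product_sets_PiM:
  assumes I: "finite I" and sc: "\<And>i. i \<in> I \<Longrightarrow> second_countable (X i)"
    and sets: "\<And>i. i \<in> I \<Longrightarrow> sets (M i) = sets (borel_of (X i))"
    and S: "openin (product_topology X I) S"
  shows "S \<in> sets (Pi\<^sub>M I M)"
proof -
  have "\<forall>i\<in>I. \<exists>B. countable B \<and> (\<forall>V\<in>B. openin (X i) V) \<and>
      (\<forall>U x. openin (X i) U \<and> x \<in> U \<longrightarrow> (\<exists>V\<in>B. x \<in> V \<and> V \<subseteq> U))"
    using sc unfolding second_countable_def by blast
  from bchoice[OF this] obtain B where B0: "\<forall>i\<in>I. countable (B i) \<and> (\<forall>V\<in>B i. openin (X i) V) \<and>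
      (\<forall>U x. openin (X i) U \<and> x \<in> U \<longrightarrow> (\<exists>V\<in>B i. x \<in> V \<and> V \<subseteq> U))" ..
  have B: "countable (B i)" "\<And>V. V \<in> B i \<Longrightarrow> openin (X i) V" if "i \<in> I" for i
    using bspec[OF B0 that] by simp_all
  define boxes where "boxes = {b \<in> Pi\<^sub>E I ` (Pi\<^sub>E I B). b \<subseteq> S}"
  have "countable boxes"
    unfolding boxes_def using B(1) I by (intro countable_Collect countable_image countable_PiE) auto
  moreover have "b \<in> sets (Pi\<^sub>M I M)" if "b \<in> boxes" for b
    using that B(2) unfolding boxes_def
    by (auto intro!: sets_PiM_I_finite I simp: sets openin_sets_borel_of PiE_iff)
  ultimately have "\<Union>boxes \<in> sets (Pi\<^sub>M I M)" by (intro sets.countable_Union) auto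
  moreover have "S = \<Union>boxes"
  proof
    show "\<Union>boxes \<subseteq> S" by (auto simp: boxes_def)
    show "S \<subseteq> \<Union>boxes"
    proof
      fix x assume x: "x \<in> S"
      obtain U where U: "\<forall>i\<in>I. openin (X i) (U i)" "x \<in> Pi\<^sub>E I U" "Pi\<^sub>E I U \<subseteq> S"
        using bspec[OF S[unfolded openin_product_topology_alt] x] by metis
      have "\<forall>i\<in>I. \<exists>V. V \<in> B i \<and> x i \<in> V \<and> V \<subseteq> U i"
      proof
        fix i assume i: "i \<in> I"
        have "openin (X i) (U i) \<and> x i \<in> U i" using U(1,2) i by auto
        then show "\<exists>V. V \<in> B i \<and> x i \<in> V \<and> V \<subseteq> U i" using bspec[OF B0 i] by blast
      qed
      from bchoice[OF this] obtain V where V: "\<forall>i\<in>I. V i \<in> B i \<and> x i \<in> V i \<and> V i \<subseteq> U i" ..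
      \<comment> \<open>The choice function is arbitrary outside \<open>I\<close>; its restriction
        lies in \<open>Pi\<^sub>E I B\<close>, which indexes the countable family of boxes.\<close>
      have "Pi\<^sub>E I V = Pi\<^sub>E I (restrict V I)" by (intro PiE_cong) auto
      moreover have "restrict V I \<in> Pi\<^sub>E I B" using V by auto
      moreover have "Pi\<^sub>E I V \<subseteq> S" using V U(3) PiE_mono[of I V U] by blast
      ultimately have "Pi\<^sub>E I V \<in> boxes" unfolding boxes_def by auto
      moreover have "x \<in> Pi\<^sub>E I V" using V U(2) by (auto simp: PiE_iff)
      ultimately show "x \<in> \<Union>boxes" by blast
    qed
  qed
  ultimately show ?thesis by simp
qed

lemma lsc_map_product_measurable:
  fixes c :: "('i \<Rightarrow> 'a) \<Rightarrow> ennreal"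
  assumes I: "finite I" and sc: "\<And>i. i \<in> I \<Longrightarrow> second_countable (X i)"
    and sets: "\<And>i. i \<in> I \<Longrightarrow> sets (M i) = sets (borel_of (X i))"
    and c: "lsc_map (product_topology X I) c"
  shows "c \<in> borel_measurable (Pi\<^sub>M I M)"
proof (rule borel_measurableI_greater)
  fix a
  have "space (Pi\<^sub>M I M) = topspace (product_topology X I)"
    using sets_eq_imp_space_eq[OF sets]
    unfolding space_PiM topspace_product_topology by (intro PiE_cong) (simp add: space_borel_of)
  then show "{y \<in> space (Pi\<^sub>M I M). a < c y} \<in> sets (Pi\<^sub>M I M)"
    using c openin_product_sets_PiM[OF I sc sets] unfolding lsc_map_def by simp
qed

section \<open>The entropic dual problem\<close>

lemma gibbs_factor: "gibbs \<epsilon> t z = exp (t / \<epsilon>) * gibbs \<epsilon> 0 z"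
  by (simp add: gibbs_def diff_divide_distrib exp_add[symmetric])

lemma gibbs_bounds: "0 < \<epsilon> \<Longrightarrow> 0 \<le> gibbs \<epsilon> 0 z" "0 < \<epsilon> \<Longrightarrow> gibbs \<epsilon> 0 z \<le> 1"
  by (auto simp: gibbs_def)

text \<open>Holds at infinite cost as well. It reduces the overlap of two slices to Jensen's
  inequality for a single cost.\<close>

lemma gibbs_add: "gibbs \<epsilon> 0 z * gibbs \<epsilon> 0 z' = gibbs \<epsilon> 0 (z + z')"
proof (cases "z = \<infinity> \<or> z' = \<infinity>")
  case False
  then have "enn2real (z + z') = enn2real z + enn2real z'"
    by (intro enn2real_plus) (auto simp: less_top)
  then show ?thesis
    using False by (simp add: gibbs_def add_divide_distrib diff_divide_distrib exp_add[symmetric])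
qed (auto simp: gibbs_def)

lemma gibbs_measurable [measurable]: "gibbs \<epsilon> t \<in> borel_measurable borel"
  unfolding gibbs_def[abs_def] by measurable

text \<open>Jensen's inequality for the exponential, through its tangent line at
  \<open>(\<integral>y. b y \<partial>M) - K / \<epsilon>\<close>.\<close>

lemma (in prob_space) gibbs_integral_ge:
  assumes g[measurable]: "g \<in> borel_measurable M" and K: "0 \<le> K" "(\<integral>\<^sup>+ y. g y \<partial>M) \<le> ennreal K"
    and \<epsilon>: "0 < \<epsilon>" and b[measurable]: "b \<in> borel_measurable M" "\<And>y. y \<in> space M \<Longrightarrow> \<bar>b y\<bar> \<le> B"
  shows "exp ((\<integral>y. b y \<partial>M) - K / \<epsilon>) \<le> (\<integral>y. exp (b y) * gibbs \<epsilon> 0 (g y) \<partial>M)"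
proof -
  define a where "a = (\<integral>y. b y \<partial>M) - K / \<epsilon>"
  have bint: "integrable M b" using b by (intro integrable_const_bound[where B = B]) auto
  have "(\<integral>\<^sup>+ y. g y \<partial>M) \<noteq> \<infinity>" using K(2) by (auto simp: top_unique)
  \<comment> \<open>\<open>enn2real\<close> sends infinity to 0, where \<open>gibbs\<close> would
    see zero cost; a finite integral confines this to a null set.\<close>
  then have fin: "AE y in M. g y \<noteq> \<infinity>" by (intro nn_integral_PInf_AE) auto
  then have "(\<integral>\<^sup>+ y. ennreal (enn2real (g y)) \<partial>M) = (\<integral>\<^sup>+ y. g y \<partial>M)"
    by (intro nn_integral_cong_AE) (auto simp: less_top)
  then have le: "(\<integral>\<^sup>+ y. ennreal (enn2real (g y)) \<partial>M) \<le> ennreal K" using K(2) by simp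
  have gint: "integrable M (\<lambda>y. enn2real (g y))"
    using le by (intro integrableI_nonneg) (auto simp: le_less_trans)
  have gle: "(\<integral>y. enn2real (g y) \<partial>M) \<le> K"
    using le K(1) by (subst (asm) nn_integral_eq_integral[OF gint]) auto
  have bound: "exp (b y) * gibbs \<epsilon> 0 (g y) \<le> exp B" if "y \<in> space M" for y
  proof -
    have "exp (b y) * gibbs \<epsilon> 0 (g y) \<le> exp B * 1"
      using b(2)[OF that] gibbs_bounds[OF \<epsilon>] by (intro mult_mono) auto
    then show ?thesis by simp
  qed
  have eint: "integrable M (\<lambda>y. exp (b y) * gibbs \<epsilon> 0 (g y))"
    using bound gibbs_bounds(1)[OF \<epsilon>] by (intro integrable_const_bound[where B = "exp B"]) auto
  \<comment> \<open>The bracket is at least one because the integral of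
    \<open>enn2real (g y)\<close> is at most \<open>K\<close>.\<close>
  have "exp a * 1 \<le> exp a * (1 + (\<integral>y. b y \<partial>M) - (\<integral>y. enn2real (g y) \<partial>M) / \<epsilon> - a)"
    using gle \<epsilon> by (intro mult_left_mono) (auto simp: a_def divide_right_mono)
  also have "\<dots> = (\<integral>y. exp a * (1 + b y - enn2real (g y) / \<epsilon> - a) \<partial>M)"
    using bint gint by (simp add: prob_space)
  also have "\<dots> \<le> (\<integral>y. exp (b y) * gibbs \<epsilon> 0 (g y) \<partial>M)"
  proof (intro integral_mono_AE eint)
    show "integrable M (\<lambda>y. exp a * (1 + b y - enn2real (g y) / \<epsilon> - a))"
      using bint gint by auto
    show "AE y in M. exp a * (1 + b y - enn2real (g y) / \<epsilon> - a) \<le> exp (b y) * gibbs \<epsilon> 0 (g y)"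
      using fin
    proof eventually_elim
      case (elim y)
      let ?t = "b y - enn2real (g y) / \<epsilon>"
      have "exp a * (1 + b y - enn2real (g y) / \<epsilon> - a) \<le> exp a * exp (?t - a)"
        using exp_ge_add_one_self[of "?t - a"] by (intro mult_left_mono) (linarith, simp)
      also have "\<dots> = exp ?t" by (simp flip: exp_add)
      also have "\<dots> = exp (b y) * gibbs \<epsilon> 0 (g y)"
        using elim by (simp add: gibbs_def exp_diff exp_minus divide_inverse)
      finally show ?case .
    qed
  qed
  finally show ?thesis by (simp add: a_def)
qed

locale entropic_transport =
  fixes N :: nat and X :: "nat \<Rightarrow> 'a topology" and \<rho> :: "nat \<Rightarrow> 'a measure"
    and c :: "(nat \<Rightarrow> 'a) \<Rightarrow> ennreal" and K \<epsilon> :: real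
  assumes N_ge_1: "1 \<le> N"
    and polish: "\<And>i. i \<in> {1..N} \<Longrightarrow> polish_topology (X i)"
    and prob_\<rho>: "\<And>i. i \<in> {1..N} \<Longrightarrow> prob_space (\<rho> i)"
    and sets_\<rho>: "\<And>i. i \<in> {1..N} \<Longrightarrow> sets (\<rho> i) = sets (borel_of (X i))"
    and lsc_c: "lsc_map (product_topology X {1..N}) c"
    and c_bound: "\<And>i. i \<in> {1..N} \<Longrightarrow>
      (SUP x\<in>topspace (X i). \<integral>\<^sup>+y. c (y(i := x)) \<partial>Pi\<^sub>M ({1..N} - {i}) \<rho>) \<le> ennreal K"
    and K_nonneg: "0 \<le> K" and \<epsilon>_pos: "0 < \<epsilon>"
begin

declare One_nat_def [simp del]

lemma space_\<rho>: "i \<in> {1..N} \<Longrightarrow> space (\<rho> i) = topspace (X i)"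
  using sets_eq_imp_space_eq[OF sets_\<rho>] by (simp add: space_borel_of)

lemma c_measurable: "c \<in> borel_measurable (Pi\<^sub>M {1..N} \<rho>)"
  by (rule lsc_map_product_measurable[OF _ polish_topology_second_countable[OF polish] sets_\<rho> lsc_c])
     auto

lemma c_slice_measurable:
  assumes "i \<in> {1..N}" "x \<in> space (\<rho> i)"
  shows "(\<lambda>y. c (y(i := x))) \<in> borel_measurable (Pi\<^sub>M ({1..N} - {i}) \<rho>)"
proof -
  have "(\<lambda>y. y(i := x)) \<in> Pi\<^sub>M ({1..N} - {i}) \<rho> \<rightarrow>\<^sub>M Pi\<^sub>M {1..N} \<rho>"
    by (rule measurable_fun_upd[where J = "{1..N} - {i}"]) (use assms in auto)
  then show ?thesis using c_measurable by (rule measurable_compose)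
qed

lemma c_slice_bound:
  assumes "i \<in> {1..N}" "x \<in> space (\<rho> i)"
  shows "(\<integral>\<^sup>+y. c (y(i := x)) \<partial>Pi\<^sub>M ({1..N} - {i}) \<rho>) \<le> ennreal K"
proof -
  have "x \<in> topspace (X i)" using assms space_\<rho> by simp
  then show ?thesis by (rule order_trans[OF SUP_upper c_bound[OF assms(1)]])
qed

sublocale gibbs_kernel "{1..N}" \<rho> "\<lambda>y. gibbs \<epsilon> 0 (c y)" "K / \<epsilon>"
proof (rule gibbs_kernel.intro)
  show "finite {1..N}" "{1..N} \<noteq> {}" using N_ge_1 by auto
  show "prob_space (\<rho> i)" if "i \<in> {1..N}" for i by (rule prob_\<rho>[OF that])
  show "(\<lambda>y. gibbs \<epsilon> 0 (c y)) \<in> borel_measurable (Pi\<^sub>M {1..N} \<rho>)"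
    by (rule measurable_compose[OF c_measurable gibbs_measurable])
  show "0 \<le> gibbs \<epsilon> 0 (c y)" "gibbs \<epsilon> 0 (c y) \<le> 1" for y
    using gibbs_bounds[OF \<epsilon>_pos] by auto
next
  fix i x and b :: "(nat \<Rightarrow> 'a) \<Rightarrow> real" and B :: real
  assume i: "i \<in> {1..N}" and x: "x \<in> space (\<rho> i)"
    and b: "b \<in> borel_measurable (Pi\<^sub>M ({1..N} - {i}) \<rho>)"
      "\<And>y. y \<in> space (Pi\<^sub>M ({1..N} - {i}) \<rho>) \<Longrightarrow> \<bar>b y\<bar> \<le> B"
  interpret S: prob_space "Pi\<^sub>M ({1..N} - {i}) \<rho>" by (intro prob_space_PiM prob_\<rho>) auto
  show "exp ((\<integral>y. b y \<partial>Pi\<^sub>M ({1..N} - {i}) \<rho>) - K / \<epsilon>)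
      \<le> (\<integral>y. exp (b y) * gibbs \<epsilon> 0 (c (y(i := x))) \<partial>Pi\<^sub>M ({1..N} - {i}) \<rho>)"
    by (rule S.gibbs_integral_ge[OF c_slice_measurable[OF i x] K_nonneg c_slice_bound[OF i x] \<epsilon>_pos b])
next
  fix i x x'
  assume i: "i \<in> {1..N}" and x: "x \<in> space (\<rho> i)" and x': "x' \<in> space (\<rho> i)"
  interpret S: prob_space "Pi\<^sub>M ({1..N} - {i}) \<rho>" by (intro prob_space_PiM prob_\<rho>) auto
  \<comment> \<open>The overlap is the case of exponent zero for the summed cost, whose slice
    integral is at most \<open>2 * K\<close>.\<close>
  let ?g = "\<lambda>y. c (y(i := x)) + c (y(i := x'))"
  have meas: "?g \<in> borel_measurable (Pi\<^sub>M ({1..N} - {i}) \<rho>)"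
    using c_slice_measurable[OF i x] c_slice_measurable[OF i x'] by measurable
  have "(\<integral>\<^sup>+y. ?g y \<partial>Pi\<^sub>M ({1..N} - {i}) \<rho>) \<le> ennreal K + ennreal K"
    using c_slice_bound[OF i x] c_slice_bound[OF i x'] c_slice_measurable[OF i x] c_slice_measurable[OF i x']
    by (simp add: nn_integral_add add_mono)
  also have "\<dots> = ennreal (2 * K)" using K_nonneg by (simp flip: ennreal_plus)
  finally have "exp ((\<integral>y. 0 \<partial>Pi\<^sub>M ({1..N} - {i}) \<rho>) - 2 * K / \<epsilon>)
      \<le> (\<integral>y. exp 0 * gibbs \<epsilon> 0 (?g y) \<partial>Pi\<^sub>M ({1..N} - {i}) \<rho>)"
    using K_nonneg by (intro S.gibbs_integral_ge[OF meas _ _ \<epsilon>_pos, of _ _ 0]) auto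
  then show "exp (- 2 * (K / \<epsilon>))
      \<le> (\<integral>y. gibbs \<epsilon> 0 (c (y(i := x))) * gibbs \<epsilon> 0 (c (y(i := x'))) \<partial>Pi\<^sub>M ({1..N} - {i}) \<rho>)"
    by (simp add: gibbs_add)
qed

section \<open>Translation between potentials and their multiples by 1/eps\<close>

definition scaled :: "(nat \<Rightarrow> 'a \<Rightarrow> real) \<Rightarrow> nat \<Rightarrow> 'a \<Rightarrow> real" where
  "scaled v i x = v i x / \<epsilon>"

lemma dens_scaled: "dens (scaled v) y = gibbs \<epsilon> (\<Sum>i\<in>{1..N}. v i (y i)) (c y)"
  by (subst gibbs_factor) (simp add: dens_def tot_def scaled_def sum_divide_distrib)

lemma c_eps_transform_scaled:
  "c_eps_transform N \<rho> c \<epsilon> i v x = - \<epsilon> * ln (partition_fn (scaled v) i x)"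
  unfolding c_eps_transform_def partition_fn_def off_def
  by (subst gibbs_factor) (simp add: scaled_def sum_divide_distrib)

lemma scaled_measurable:
  assumes "L1_tuple N \<rho> v" "i \<in> {1..N}"
  shows "integrable (\<rho> i) (scaled v i)" "scaled v i \<in> borel_measurable (\<rho> i)"
proof -
  show "integrable (\<rho> i) (scaled v i)"
    using assms unfolding scaled_def[abs_def] L1_tuple_def by auto
  then show "scaled v i \<in> borel_measurable (\<rho> i)" by (rule borel_measurable_integrable)
qed

lemma entropic_dual_finite:
  assumes v: "L1_tuple N \<rho> v" and int: "integrable P (dens (scaled v))"
  shows "entropic_dual N \<rho> c \<epsilon> v = ereal (\<epsilon> * dual (scaled v))"
proof -
  have nn: "(\<integral>\<^sup>+y. ennreal (dens (scaled v) y) \<partial>P) = ennreal (\<integral>y. dens (scaled v) y \<partial>P)"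
    using dens_nonneg by (intro nn_integral_eq_integral int AE_I2) auto
  have nonneg: "0 \<le> (\<integral>y. dens (scaled v) y \<partial>P)"
    using dens_nonneg by (intro integral_nonneg_AE AE_I2) auto
  have sum: "(\<Sum>i\<in>{1..N}. \<integral>x. scaled v i x \<partial>\<rho> i) = (\<Sum>i\<in>{1..N}. \<integral>x. v i x \<partial>\<rho> i) / \<epsilon>"
    by (simp add: scaled_def sum_divide_distrib)
  have "entropic_dual N \<rho> c \<epsilon> v
      = ereal (\<Sum>i\<in>{1..N}. \<integral>x. v i x \<partial>\<rho> i) - ereal \<epsilon> * ereal (\<integral>y. dens (scaled v) y \<partial>P) + ereal \<epsilon>"
    unfolding entropic_dual_def dens_scaled[symmetric] nn using nonneg by (simp add: enn2ereal_ennreal)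
  also have "\<dots> = ereal (\<epsilon> * dual (scaled v))"
    using \<epsilon>_pos by (simp add: dual_def sum algebra_simps)
  finally show ?thesis .
qed

text \<open>Removes from the competition exactly those tuples for which \<open>dual\<close> would
  not represent the functional.\<close>

lemma entropic_dual_infinite:
  assumes v: "L1_tuple N \<rho> v" and nint: "\<not> integrable P (dens (scaled v))"
  shows "entropic_dual N \<rho> c \<epsilon> v = - \<infinity>"
proof -
  have meas: "dens (scaled v) \<in> borel_measurable P"
    by (intro dens_measurable scaled_measurable(2)[OF v])
  have "(\<integral>\<^sup>+y. ennreal (dens (scaled v) y) \<partial>P) = \<infinity>"
  proof (rule ccontr)
    assume "(\<integral>\<^sup>+y. ennreal (dens (scaled v) y) \<partial>P) \<noteq> \<infinity>"
    then have "(\<integral>\<^sup>+y. ennreal (dens (scaled v) y) \<partial>P) < \<infinity>" by (simp add: less_top)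
    then have "integrable P (dens (scaled v))"
      using dens_nonneg by (intro integrableI_nonneg[OF meas] AE_I2) auto
    then show False using nint by simp
  qed
  then show ?thesis
    unfolding entropic_dual_def dens_scaled[symmetric] using \<epsilon>_pos by simp
qed

text \<open>The recursion for \<open>u\<close> is given only at points of the spaces, so values
  elsewhere have to be shown irrelevant.\<close>

lemma partition_fn_cong:
  assumes "\<And>j x. j \<in> {1..N} - {i} \<Longrightarrow> x \<in> space (\<rho> j) \<Longrightarrow> f j x = g j x"
  shows "partition_fn f i = partition_fn g i"
proof -
  have "off f i y = off g i y" if y: "y \<in> space (P' i)" for y
    unfolding off_def
  proof (rule sum.cong[OF refl])
    fix j assume j: "j \<in> {1..N} - {i}"
    show "f j (y j) = g j (y j)"
      by (rule assms[OF j PiE_mem[OF y[unfolded space_PiM] j]])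
  qed
  then show ?thesis
    unfolding partition_fn_def by (intro ext Bochner_Integration.integral_cong) auto
qed

text \<open>A competitor either has integrable density and is covered by
  \<open>fixed_point_optimal\<close>, or has the value \<open>-\<infinity>\<close>. Constants are
  rescaled by \<open>\<epsilon>\<close> in passing between the two forms.\<close>

lemma fixed_point_maximizers:
  assumes g: "tot_bounded R g" and one: "\<And>i x. i \<in> {1..N} \<Longrightarrow> x \<in> space (\<rho> i) \<Longrightarrow> marg g i x = 1"
  defines "ubar \<equiv> \<lambda>i x. \<epsilon> * g i x"
  shows "dual_maximizer N \<rho> c \<epsilon> ubar"
    and "L1_tuple N \<rho> v \<Longrightarrow> dual_maximizer N \<rho> c \<epsilon> v \<longleftrightarrow>
      (\<exists>a :: nat \<Rightarrow> real. (\<Sum>i\<in>{1..N}. a i) = 0 \<and> (\<forall>i\<in>{1..N}. AE x in \<rho> i. v i x = ubar i x + a i))"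
proof -
  have sc: "scaled ubar = g" using \<epsilon>_pos by (simp add: fun_eq_iff scaled_def ubar_def)
  have L1: "L1_tuple N \<rho> ubar"
    using tot_bounded_integrable[OF g] by (auto simp: L1_tuple_def ubar_def)
  have val: "entropic_dual N \<rho> c \<epsilon> ubar = ereal (\<epsilon> * dual g)"
    using entropic_dual_finite[OF L1] dens_integrable[OF g] by (simp add: sc)
  have le: "entropic_dual N \<rho> c \<epsilon> v \<le> ereal (\<epsilon> * dual g)" if v: "L1_tuple N \<rho> v" for v
  proof (cases "integrable P (dens (scaled v))")
    case True
    have "dual (scaled v) \<le> dual g"
      by (rule fixed_point_optimal(1)[OF g one scaled_measurable(1)[OF v] True])
    then show ?thesis using entropic_dual_finite[OF v True] \<epsilon>_pos by simp
  next
    case False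
    then show ?thesis using entropic_dual_infinite[OF v] by simp
  qed
  have iff: "dual_maximizer N \<rho> c \<epsilon> v \<longleftrightarrow> entropic_dual N \<rho> c \<epsilon> v = ereal (\<epsilon> * dual g)"
    if v: "L1_tuple N \<rho> v" for v
  proof
    assume "dual_maximizer N \<rho> c \<epsilon> v"
    then have "\<not> entropic_dual N \<rho> c \<epsilon> v < entropic_dual N \<rho> c \<epsilon> ubar"
      using L1 by (auto simp: dual_maximizer_def is_arg_max_def)
    then show "entropic_dual N \<rho> c \<epsilon> v = ereal (\<epsilon> * dual g)"
      unfolding val using le[OF v] by (simp add: antisym not_less)
  next
    assume eq: "entropic_dual N \<rho> c \<epsilon> v = ereal (\<epsilon> * dual g)"
    show "dual_maximizer N \<rho> c \<epsilon> v"
      unfolding dual_maximizer_def is_arg_max_def eq using v le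
      by (simp add: not_less[symmetric])
  qed
  show "dual_maximizer N \<rho> c \<epsilon> ubar" using iff[OF L1] val by simp
  assume v: "L1_tuple N \<rho> v"
  show "dual_maximizer N \<rho> c \<epsilon> v \<longleftrightarrow>
      (\<exists>a :: nat \<Rightarrow> real. (\<Sum>i\<in>{1..N}. a i) = 0 \<and> (\<forall>i\<in>{1..N}. AE x in \<rho> i. v i x = ubar i x + a i))"
    unfolding iff[OF v]
  proof
    assume eq: "entropic_dual N \<rho> c \<epsilon> v = ereal (\<epsilon> * dual g)"
    have int: "integrable P (dens (scaled v))" using entropic_dual_infinite[OF v] eq by auto
    have "dual (scaled v) = dual g" using eq entropic_dual_finite[OF v int] \<epsilon>_pos by simp
    from fixed_point_optimal(2)[OF g one scaled_measurable(1)[OF v] int this]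
    obtain a where a: "(\<Sum>i\<in>{1..N}. a i) = 0" "\<forall>i\<in>{1..N}. AE x in \<rho> i. scaled v i x = g i x + a i"
      by blast
    have "AE x in \<rho> i. v i x = ubar i x + \<epsilon> * a i" if "i \<in> {1..N}" for i
      using bspec[OF a(2) that]
      by eventually_elim (use \<epsilon>_pos in \<open>simp add: scaled_def ubar_def field_simps\<close>)
    moreover have "(\<Sum>i\<in>{1..N}. \<epsilon> * a i) = 0" using a(1) by (simp flip: sum_distrib_left)
    ultimately show "\<exists>a. (\<Sum>i\<in>{1..N}. a i) = 0 \<and> (\<forall>i\<in>{1..N}. AE x in \<rho> i. v i x = ubar i x + a i)"
      by (intro exI[of _ "\<lambda>i. \<epsilon> * a i"]) blast
  next
    assume "\<exists>a. (\<Sum>i\<in>{1..N}. a i) = 0 \<and> (\<forall>i\<in>{1..N}. AE x in \<rho> i. v i x = ubar i x + a i)"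
    then obtain a where a: "(\<Sum>i\<in>{1..N}. a i) = 0" "\<forall>i\<in>{1..N}. AE x in \<rho> i. v i x = ubar i x + a i"
      by blast
    have ae: "AE x in \<rho> i. scaled v i x = g i x + a i / \<epsilon>" if "i \<in> {1..N}" for i
      using bspec[OF a(2) that]
      by eventually_elim (use \<epsilon>_pos in \<open>simp add: scaled_def ubar_def field_simps\<close>)
    have "(\<Sum>i\<in>{1..N}. a i / \<epsilon>) = 0" using a(1) by (simp flip: sum_divide_distrib)
    note sd = shifted_dual[OF g this scaled_measurable(2)[OF v] ae]
    show "entropic_dual N \<rho> c \<epsilon> v = ereal (\<epsilon> * dual g)"
      using entropic_dual_finite[OF v sd(1)] sd(2) by simp
  qed
qed

text \<open>The scaled means lie in \<open>[0, K / \<epsilon>]\<close>, so the lower bound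
  \<open>- (N - 1) * K / \<epsilon>\<close> is at most \<open>N * K / \<epsilon>\<close> below the
  mean; hence the factor \<open>card I\<close> in \<open>admissible\<close>. A nonnegative value
  also excludes \<open>-\<infinity>\<close> and makes the density integrable.\<close>

lemma admissible_initial:
  assumes L1: "L1_tuple N \<rho> v" and D: "0 \<le> entropic_dual N \<rho> c \<epsilon> v"
    and mean: "\<And>i. i \<in> {1..N} \<Longrightarrow> 0 \<le> (\<integral>x. v i x \<partial>\<rho> i)"
    and bounds: "\<And>i x. i \<in> {1..N} \<Longrightarrow> x \<in> topspace (X i) \<Longrightarrow> - (real N - 1) * K \<le> v i x \<and> v i x \<le> K"
  shows "admissible (scaled v)"
proof -
  have mean_scaled: "mean (scaled v) i = (\<integral>x. v i x \<partial>\<rho> i) / \<epsilon>" for i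
    by (simp add: mean_def scaled_def)
  have m: "0 \<le> mean (scaled v) i" "mean (scaled v) i \<le> K / \<epsilon>" if i: "i \<in> {1..N}" for i
  proof -
    interpret prob_space "\<rho> i" by (rule prob_\<rho>[OF i])
    have "(\<integral>x. v i x \<partial>\<rho> i) \<le> (\<integral>x. K \<partial>\<rho> i)"
      using L1 i bounds[OF i] space_\<rho>[OF i] by (intro integral_mono) (auto simp: L1_tuple_def)
    then have "(\<integral>x. v i x \<partial>\<rho> i) \<le> K" by (simp add: prob_space)
    then show "0 \<le> mean (scaled v) i" "mean (scaled v) i \<le> K / \<epsilon>"
      using mean[OF i] \<epsilon>_pos by (auto simp: mean_scaled divide_right_mono)
  qed
  have b: "- (real N - 1) * (K / \<epsilon>) \<le> scaled v i x" "scaled v i x \<le> K / \<epsilon>"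
    if "i \<in> {1..N}" "x \<in> space (\<rho> i)" for i x
    using bounds[of i x] that space_\<rho>[of i] \<epsilon>_pos divide_right_mono[of "- (real N - 1) * K" "v i x" \<epsilon>]
    by (auto simp: scaled_def divide_right_mono)
  have int: "integrable P (dens (scaled v))" using entropic_dual_infinite[OF L1] D by auto
  have "0 \<le> dual (scaled v)"
    using D entropic_dual_finite[OF L1 int] \<epsilon>_pos by (simp add: zero_le_mult_iff)
  moreover have "(\<Sum>i\<in>{1..N}. mean (scaled v) i) \<le> (\<Sum>i\<in>{1..N}. K / \<epsilon>)"
    by (intro sum_mono m)
  moreover have "0 \<le> (\<Sum>i\<in>{1..N}. mean (scaled v) i)" by (intro sum_nonneg m)
  moreover have "mean (scaled v) i - real N * (K / \<epsilon>) \<le> scaled v i x"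
      "scaled v i x \<le> mean (scaled v) i + K / \<epsilon>"
    if "i \<in> {1..N}" "x \<in> space (\<rho> i)" for i x
    using m[OF that(1)] b[OF that] by (auto simp: algebra_simps)
  ultimately show ?thesis
    unfolding admissible_def using scaled_measurable(2)[OF L1] by simp
qed

lemma sinkhorn_converges:
  assumes adm: "admissible (scaled (u 0))"
    and rec: "\<And>n i x. i \<in> {1..N} \<Longrightarrow> x \<in> topspace (X i) \<Longrightarrow>
       u (Suc n) i x = c_eps_transform N \<rho> c \<epsilon> i (\<lambda>j. if j < i then u (Suc n) j else u n j) x"
  obtains R g where "tot_bounded R g"
    "\<And>i x. i \<in> {1..N} \<Longrightarrow> x \<in> space (\<rho> i) \<Longrightarrow> marg g i x = 1"
    "\<And>i. i \<in> {1..N} \<Longrightarrow> uniform_limit (topspace (X i)) (\<lambda>n. u n i) (\<lambda>x. \<epsilon> * g i x) sequentially"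
proof -
  define h where "h = (\<lambda>n i. scaled (\<lambda>j. if j < i then u (Suc n) j else u n j))"
  \<comment> \<open>\<open>gibbs_sweep\<close> asks for equations between functions, whereas
    \<open>u\<close> is constrained only on the spaces and for indices in \<open>{1..N}\<close>. So
    \<open>f\<close> is rebuilt everywhere; since \<open>h\<close> refers to \<open>u\<close>
    itself, recursion on \<open>n\<close> alone suffices.\<close>
  define f where "f = rec_nat (scaled (u 0))
    (\<lambda>n prev i. if i \<in> {1..N} then (\<lambda>x. - ln (partition_fn (h n i) i x)) else prev i)"
  have f0: "f 0 = scaled (u 0)" by (simp add: f_def)
  have fS: "f (Suc n) i = (\<lambda>x. - ln (partition_fn (h n i) i x))" if "i \<in> {1..N}" for n i
    using that by (simp add: f_def)
  have fu: "f n i x = scaled (u n) i x" if i: "i \<in> {1..N}" and x: "x \<in> space (\<rho> i)" for n i x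
  proof (cases n)
    case 0
    then show ?thesis by (simp add: f0)
  next
    case (Suc m)
    have "u (Suc m) i x = - \<epsilon> * ln (partition_fn (h m i) i x)"
      unfolding h_def c_eps_transform_scaled[symmetric] using rec[OF i] x space_\<rho>[OF i] by simp
    then show ?thesis using fS[OF i] \<epsilon>_pos by (simp add: Suc scaled_def)
  qed
  interpret gibbs_sweep N \<rho> "\<lambda>y. gibbs \<epsilon> 0 (c y)" "K / \<epsilon>" f
  proof unfold_locales
    show "admissible (f 0)" using adm by (simp add: f0)
    show "f (Suc n) j = f n j" if "j \<notin> {1..N}" for n j
      using that unfolding f_def old.nat.rec(2) by (simp only: if_False)
    show "f (Suc n) i = (\<lambda>x. - ln (partition_fn (\<lambda>j. if j < i then f (Suc n) j else f n j) i x))"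
      if i: "i \<in> {1..N}" for n i
    proof -
      have "partition_fn (h n i) i = partition_fn (\<lambda>j. if j < i then f (Suc n) j else f n j) i"
        by (rule partition_fn_cong) (auto simp: h_def fu scaled_def)
      then show ?thesis using fS[OF i] by simp
    qed
  qed
  obtain g where g: "\<And>i. i \<in> {1..N} \<Longrightarrow> uniform_limit (space (\<rho> i)) (\<lambda>n. f n i) (g i) sequentially"
    "tot_bounded radius g" "\<And>i x. i \<in> {1..N} \<Longrightarrow> x \<in> space (\<rho> i) \<Longrightarrow> marg g i x = 1"
    by (rule converges) (rule that; blast)
  have "uniform_limit (topspace (X i)) (\<lambda>n. u n i) (\<lambda>x. \<epsilon> * g i x) sequentially"
    if i: "i \<in> {1..N}" for i
  proof -
    have "uniform_limit (space (\<rho> i)) (\<lambda>n x. \<epsilon> * f n i x) (\<lambda>x. \<epsilon> * g i x) sequentially"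
      by (rule bounded_linear.uniform_limit[OF bounded_linear_mult_right g(1)[OF i]])
    moreover have "\<epsilon> * f n i x = u n i x" if "x \<in> space (\<rho> i)" for n x
      using fu[OF i that] \<epsilon>_pos by (simp add: scaled_def)
    ultimately have "uniform_limit (space (\<rho> i)) (\<lambda>n. u n i) (\<lambda>x. \<epsilon> * g i x) sequentially"
      by (subst (asm) uniform_limit_cong') auto
    then show ?thesis by (simp add: space_\<rho>[OF i])
  qed
  then show ?thesis using that[OF g(2,3)] by blast
qed

end

theorem theorem5p10:
  fixes N :: nat
    and X :: "nat \<Rightarrow> 'a topology"
    and \<rho> :: "nat \<Rightarrow> 'a measure"
    and c :: "(nat \<Rightarrow> 'a) \<Rightarrow> ennreal"
    and K \<epsilon> :: real
    and u :: "nat \<Rightarrow> nat \<Rightarrow> 'a \<Rightarrow> real"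
  assumes "N \<ge> 2"
    and "\<And>i. i \<in> {1..N} \<Longrightarrow> polish_topology (X i)"
    and "\<And>i. i \<in> {1..N} \<Longrightarrow> prob_space (\<rho> i)"
    and "\<And>i. i \<in> {1..N} \<Longrightarrow> sets (\<rho> i) = sets (borel_of (X i))"
    and "lsc_map (product_topology X {1..N}) c"
    and "\<And>i. i \<in> {1..N} \<Longrightarrow>
           (SUP x\<in>topspace (X i). \<integral>\<^sup>+y. c (y(i := x)) \<partial>Pi\<^sub>M ({1..N} - {i}) \<rho>) \<le> ennreal K"
    and "\<epsilon> > 0"
    and "L1_tuple N \<rho> (u 0)"
    and "entropic_dual N \<rho> c \<epsilon> (u 0) \<ge> 0"
    and "\<And>i. i \<in> {1..N} \<Longrightarrow> (\<integral>x. u 0 i x \<partial>\<rho> i) \<ge> 0"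
    and "\<And>i x. i \<in> {1..N} \<Longrightarrow> x \<in> topspace (X i) \<Longrightarrow>
           - (real N - 1) * K \<le> u 0 i x \<and> u 0 i x \<le> K"
    and "\<And>n i x. i \<in> {1..N} \<Longrightarrow> x \<in> topspace (X i) \<Longrightarrow>
           u (Suc n) i x =
             c_eps_transform N \<rho> c \<epsilon> i (\<lambda>j. if j < i then u (Suc n) j else u n j) x"
  shows "\<exists>ubar.
           dual_maximizer N \<rho> c \<epsilon> ubar \<and>
           (\<forall>i\<in>{1..N}. \<forall>C. compactin (X i) C \<longrightarrow>
              uniform_limit C (\<lambda>n. u n i) (ubar i) sequentially) \<and>
           (\<forall>v. L1_tuple N \<rho> v \<longrightarrow>
              (dual_maximizer N \<rho> c \<epsilon> v \<longleftrightarrow>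
                (\<exists>a :: nat \<Rightarrow> real. (\<Sum>i\<in>{1..N}. a i) = 0 \<and>
                   (\<forall>i\<in>{1..N}. AE x in \<rho> i. v i x = ubar i x + a i))))"
proof -
  \<comment> \<open>\<open>ennreal\<close> truncates at zero, so the cost bound does not reveal the
    sign of \<open>K\<close>. The two bounds on \<open>u 0\<close> at a single point, which exists
    in a probability space, give \<open>0 \<le> N * K\<close>.\<close>
  have "1 \<in> {1..N}" using assms(1) by auto
  then interpret \<rho>1: prob_space "\<rho> 1" by (rule assms(3))
  have "space (\<rho> 1) = topspace (X 1)"
    using sets_eq_imp_space_eq[OF assms(4)[of 1]] assms(1) by (simp add: space_borel_of)
  then obtain x where x: "x \<in> topspace (X 1)" using \<rho>1.not_empty by (metis ex_in_conv)
  have "- (real N - 1) * K \<le> K"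
    using assms(11)[OF \<open>1 \<in> {1..N}\<close> x] by linarith
  then have "0 \<le> real N * K" by (simp add: algebra_simps)
  then have K: "0 \<le> K" using assms(1) by (simp add: zero_le_mult_iff)
  interpret entropic_transport N X \<rho> c K \<epsilon>
    by (rule entropic_transport.intro) (use assms(1-7) K in auto)
  have adm: "admissible (scaled (u 0))"
    by (rule admissible_initial[OF assms(8,9,10,11)])
  show ?thesis
  proof (rule sinkhorn_converges[where u = u, OF adm])
    show "u (Suc n) i x = c_eps_transform N \<rho> c \<epsilon> i (\<lambda>j. if j < i then u (Suc n) j else u n j) x"
      if "i \<in> {1..N}" "x \<in> topspace (X i)" for n i x
      by (rule assms(12)[OF that])
    fix R g
    assume g: "tot_bounded R g"
      "\<And>i x. i \<in> {1..N} \<Longrightarrow> x \<in> space (\<rho> i) \<Longrightarrow> marg g i x = 1"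
      "\<And>i. i \<in> {1..N} \<Longrightarrow> uniform_limit (topspace (X i)) (\<lambda>n. u n i) (\<lambda>x. \<epsilon> * g i x) sequentially"
    show ?thesis
    proof (intro exI[of _ "\<lambda>i x. \<epsilon> * g i x"] conjI ballI allI impI)
      show "dual_maximizer N \<rho> c \<epsilon> (\<lambda>i x. \<epsilon> * g i x)"
        by (rule fixed_point_maximizers(1)[OF g(1,2)])
      \<comment> \<open>Convergence is uniform on the whole space and restricts to
        \<open>C\<close>.\<close>
      show "uniform_limit C (\<lambda>n. u n i) (\<lambda>x. \<epsilon> * g i x) sequentially"
        if "i \<in> {1..N}" "compactin (X i) C" for i C
        by (rule uniform_limit_on_subset[OF g(3)[OF that(1)] compactin_subset_topspace[OF that(2)]])
      show "dual_maximizer N \<rho> c \<epsilon> v \<longleftrightarrow>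
          (\<exists>a. (\<Sum>i\<in>{1..N}. a i) = 0 \<and> (\<forall>i\<in>{1..N}. AE x in \<rho> i. v i x = \<epsilon> * g i x + a i))"
        if "L1_tuple N \<rho> v" for v
        by (rule fixed_point_maximizers(2)[OF g(1,2) that])
    qed
  qed
qed

end
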